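(* Let $\lambda_1,\ldots,\lambda_m\in\mathbb{C}^*$ be pairwise distinct. Then the tensor product $\mathfrak{L}$-module $\bm{T}=\big(\bigotimes_{i=1}^m\Phi(\lambda_i,\alpha_i,\beta_i,\gamma_i,h_i(t_i))\big)\otimes V$ described in the context is irreducible.
   Context: All vector spaces are over $\mathbb{C}$; $\mathbb{C}^*$ denotes the nonzero complex numbers, $\mathbb{Z}_+$ the nonnegative integers, $\mathbb{N}$ the positive integers. The BMS-Kac-Moody algebra $\mathfrak{L}$ is the Lie algebra with basis $\{L_m,W_m,I_m,J_m\mid m\in\mathbb{Z}\}$ and nontrivial brackets $[L_m,L_n]=(n-m)L_{m+n}$, $[L_m,W_n]=(n-m)W_{m+n}$, $[L_m,I_n]=nI_{m+n}$, $[L_m,J_n]=nJ_{m+n}$, $[W_m,I_n]=-nJ_{m+n}$ for $m,n\in\mathbb{Z}$ (all other brackets of basis elements, up to skew-symmetry, are zero). It is $\mathbb{Z}$-graded with $\mathfrak{L}_n=\mathbb{C}L_n\oplus\mathbb{C}W_n\oplus\mathbb{C}I_n\oplus\mathbb{C}J_n$. For $\lambda\in\mathbb{C}^*$, $\alpha,\beta,\gamma\in\mathbb{C}$, $h(t)\in\mathbb{C}[t]$, the $\mathfrak{L}$-module $\Phi(\lambda,\alpha,\beta,\gamma,h(t))$ is the vector space $\mathbb{C}[s,t]$ with, for $f(s,t)\in\mathbb{C}[s,t]$ and $n\in\mathbb{Z}$, $L_n(f(s,t))=\lambda^n(s+h_{(n)}(t))f(s-n,t)-n\lambda^n(t-n\alpha)\frac{\partial}{\partial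 t}(f(s-n,t))$, $W_n(f(s,t))=\lambda^n(t-n\alpha)f(s-n,t)$, $I_n(f(s,t))=\lambda^n\big(\gamma-n\beta H(t)\big)f(s-n,t)+n\lambda^n\beta\frac{\partial}{\partial t}(f(s-n,t))$, $J_n(f(s,t))=\lambda^n\beta f(s-n,t)$, where $H(t)=\frac{h(t)-h(\alpha)}{t-\alpha}$ and $h_{(n)}(t)=nh(t)-n(n-1)\alpha H(t)$. An $\mathfrak{L}$-module $V$ is restricted if for every $v\in V$ there is $k\in\mathbb{Z}_+$ with $\mathfrak{L}_n\cdot v=0$ for all $n\geq k$. Tensor product module: let $m\in\mathbb{N}$. For $1\leq i\leq m$ let $\gamma_i\in\mathbb{C}$, let $\lambda_i\in\mathbb{C}^*$, $\alpha_i,\beta_i\in\mathbb{C}$ with $\alpha_i\neq0$ or $\beta_i\neq0$, and $h_i(t_i)\in\mathbb{C}[t_i]$; regard $\Phi(\lambda_i,\alpha_i,\beta_i,\gamma_i,h_i(t_i))$ as $\mathbb{C}[s_i,t_i]$. Let $V$ be an irreducible restricted $\mathfrak{L}$-module. Then $\bm{T}=\big(\bigotimes_{i=1}^m\Phi(\lambda_i,\alpha_i,\beta_i,\gamma_i,h_i(t_i))\big)\otimes V$ with the usual tensor product action. *)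

theory Defs
  imports Complex_Main "HOL-Library.Poly_Mapping" "HOL-Computational_Algebra.Polynomial"
begin

class complex_vector = ab_group_add +
  fixes scaleC :: "complex \<Rightarrow> 'a \<Rightarrow> 'a"  (infixr \<open>*\<^sub>C\<close> 75)
  assumes scaleC_add_right: "a *\<^sub>C (x + y) = a *\<^sub>C x + a *\<^sub>C y"
    and scaleC_add_left: "(a + b) *\<^sub>C x = a *\<^sub>C x + b *\<^sub>C x"
    and scaleC_scaleC: "a *\<^sub>C b *\<^sub>C x = (a * b) *\<^sub>C x"
    and scaleC_one: "1 *\<^sub>C x = x"

global_interpretation complex_vector:
  vector_space "scaleC :: complex \<Rightarrow> 'a \<Rightarrow> 'a::complex_vector"
  by standard (simp_all add: scaleC_add_right scaleC_add_left scaleC_scaleC scaleC_one)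

abbreviation clinear :: "('a::complex_vector \<Rightarrow> 'b::complex_vector) \<Rightarrow> bool"
  where "clinear \<equiv> Vector_Spaces.linear scaleC scaleC"

lemma clinearI:
  assumes "\<And>x y. f (x + y) = f x + f y" and "\<And>c x. f (c *\<^sub>C x) = c *\<^sub>C f x"
  shows "clinear f"
  using assms by (intro Vector_Spaces.linear.intro module_hom.intro module_hom_axioms.intro)
    (simp_all add: complex_vector.module_axioms complex_vector.vector_space_axioms)

lemma clinear_add: "clinear f \<Longrightarrow> f (x + y) = f x + f y"
  and clinear_scale: "clinear f \<Longrightarrow> f (c *\<^sub>C x) = c *\<^sub>C f x"
  and clinear_0: "clinear f \<Longrightarrow> f 0 = 0"
  and clinear_diff: "clinear f \<Longrightarrow> f (x - y) = f x - f y"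
  unfolding Vector_Spaces.linear_def
  by (blast intro: module_hom.add module_hom.scale module_hom.zero module_hom.diff)+

instantiation complex :: complex_vector
begin
definition scaleC_complex :: "complex \<Rightarrow> complex \<Rightarrow> complex"
  where "scaleC_complex c x = c * x"
instance by standard (simp_all add: scaleC_complex_def algebra_simps)
end

instantiation poly :: (complex_vector) complex_vector
begin
definition scaleC_poly :: "complex \<Rightarrow> 'a poly \<Rightarrow> 'a poly"
  where "scaleC_poly c p = map_poly (scaleC c) p"
instance
  by standard
    (simp_all add: scaleC_poly_def poly_eq_iff coeff_map_poly
      scaleC_add_right scaleC_add_left scaleC_scaleC scaleC_one)
end

instantiation poly_mapping :: (type, complex_vector) complex_vector
begin
definition scaleC_poly_mapping :: "complex \<Rightarrow> ('a \<Rightarrow>\<^sub>0 'b) \<Rightarrow> 'a \<Rightarrow>\<^sub>0 'b"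
  where "scaleC_poly_mapping c f = Poly_Mapping.map (scaleC c) f"

lemma lookup_scaleC:
  "Poly_Mapping.lookup (c *\<^sub>C f) x = c *\<^sub>C Poly_Mapping.lookup f x" for f :: "'a \<Rightarrow>\<^sub>0 'b"
  unfolding scaleC_poly_mapping_def by transfer (simp add: when_def)

instance
  by standard
    (simp_all add: poly_mapping_eq_iff fun_eq_iff lookup_scaleC lookup_add
      scaleC_add_right scaleC_add_left scaleC_scaleC scaleC_one)
end

definition free_ext :: "('x \<Rightarrow> 'b::complex_vector) \<Rightarrow> ('x \<Rightarrow>\<^sub>0 complex) \<Rightarrow> 'b"
  where "free_ext f u = (\<Sum>x \<in> Poly_Mapping.keys u. Poly_Mapping.lookup u x *\<^sub>C f x)"

abbreviation free_gen :: "'x \<Rightarrow> 'x \<Rightarrow>\<^sub>0 complex"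
  where "free_gen x \<equiv> Poly_Mapping.single x 1"

lemma free_ext_superset:
  assumes "finite S" "Poly_Mapping.keys u \<subseteq> S"
  shows "free_ext f u = (\<Sum>x\<in>S. Poly_Mapping.lookup u x *\<^sub>C f x)"
  unfolding free_ext_def using assms
  by (intro sum.mono_neutral_left) (auto simp: in_keys_iff)

lemma clinear_free_ext: "clinear (free_ext f)"
proof (rule clinearI)
  fix u v :: "'a \<Rightarrow>\<^sub>0 complex" and c
  let ?S = "Poly_Mapping.keys u \<union> Poly_Mapping.keys v"
  show "free_ext f (u + v) = free_ext f u + free_ext f v"
    using keys_add[of u v]
    by (simp add: free_ext_superset[of ?S] lookup_add scaleC_add_left sum.distrib)
  have "Poly_Mapping.keys (c *\<^sub>C u) \<subseteq> Poly_Mapping.keys u"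
    by (auto simp: in_keys_iff lookup_scaleC)
  then show "free_ext f (c *\<^sub>C u) = c *\<^sub>C free_ext f u"
    by (simp add: free_ext_superset[of "Poly_Mapping.keys u"] lookup_scaleC scaleC_complex_def
        complex_vector.scale_sum_right scaleC_scaleC)
qed

lemma free_ext_gen [simp]: "free_ext f (free_gen x) = f x"
  by (simp add: free_ext_def scaleC_one)

lemma free_decompose: "u = free_ext free_gen u"
proof (rule poly_mapping_eqI)
  fix k
  show "Poly_Mapping.lookup u k = Poly_Mapping.lookup (free_ext free_gen u) k"
    by (simp add: free_ext_def lookup_sum lookup_scaleC lookup_single scaleC_complex_def when_def
        in_keys_iff if_distrib cong: if_cong)
qed

datatype bms_basis = bL int | bW int | bI int | bJ int

type_synonym bms = "bms_basis \<Rightarrow>\<^sub>0 complex"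

fun basis_bracket :: "bms_basis \<Rightarrow> bms_basis \<Rightarrow> bms" where
  "basis_bracket (bL m) (bL n) = of_int (n - m) *\<^sub>C free_gen (bL (m + n))"
| "basis_bracket (bL m) (bW n) = of_int (n - m) *\<^sub>C free_gen (bW (m + n))"
| "basis_bracket (bL m) (bI n) = of_int n *\<^sub>C free_gen (bI (m + n))"
| "basis_bracket (bL m) (bJ n) = of_int n *\<^sub>C free_gen (bJ (m + n))"
| "basis_bracket (bW m) (bI n) = of_int (- n) *\<^sub>C free_gen (bJ (m + n))"
| "basis_bracket (bW n) (bL m) = - (of_int (n - m) *\<^sub>C free_gen (bW (m + n)))"
| "basis_bracket (bI n) (bL m) = - (of_int n *\<^sub>C free_gen (bI (m + n)))"
| "basis_bracket (bJ n) (bL m) = - (of_int n *\<^sub>C free_gen (bJ (m + n)))"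
| "basis_bracket (bI n) (bW m) = - (of_int (- n) *\<^sub>C free_gen (bJ (m + n)))"
| "basis_bracket _ _ = 0"

definition bms_bracket :: "bms \<Rightarrow> bms \<Rightarrow> bms"
  where "bms_bracket x y = free_ext (\<lambda>a. free_ext (basis_bracket a) y) x"

definition bms_graded :: "int \<Rightarrow> bms set"
  where "bms_graded n =
    complex_vector.span {free_gen (bL n), free_gen (bW n), free_gen (bI n), free_gen (bJ n)}"

definition bms_module :: "(bms \<Rightarrow> 'v::complex_vector \<Rightarrow> 'v) \<Rightarrow> bool"
  where "bms_module \<rho> \<longleftrightarrow>
    (\<forall>x. clinear (\<rho> x)) \<and> (\<forall>v. clinear (\<lambda>x. \<rho> x v)) \<and>
    (\<forall>x y v. \<rho> (bms_bracket x y) v = \<rho> x (\<rho> y v) - \<rho> y (\<rho> x v))"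

definition bms_submodule :: "(bms \<Rightarrow> 'v::complex_vector \<Rightarrow> 'v) \<Rightarrow> 'v set \<Rightarrow> bool"
  where "bms_submodule \<rho> N \<longleftrightarrow> complex_vector.subspace N \<and> (\<forall>x. \<forall>v\<in>N. \<rho> x v \<in> N)"

definition bms_irreducible :: "(bms \<Rightarrow> 'v::complex_vector \<Rightarrow> 'v) \<Rightarrow> bool"
  where "bms_irreducible \<rho> \<longleftrightarrow>
    bms_module \<rho> \<and> (\<exists>v::'v. v \<noteq> 0) \<and> (\<forall>N. bms_submodule \<rho> N \<longrightarrow> N = {0} \<or> N = UNIV)"

definition bms_restricted :: "(bms \<Rightarrow> 'v::complex_vector \<Rightarrow> 'v) \<Rightarrow> bool"
  where "bms_restricted \<rho> \<longleftrightarrow>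
    (\<forall>v. \<exists>k::nat. \<forall>n \<ge> int k. \<forall>x \<in> bms_graded n. \<rho> x v = 0)"

text \<open>
  \<open>\<complex>[s,t]\<close> is represented as \<open>(\<complex>[t])[s]\<close>, i.e. by the type \<open>complex poly poly\<close> whose outer
  variable is \<open>s\<close> and whose inner variable is \<open>t\<close>; the constant polynomial \<open>[:p:]\<close> is \<open>p(t)\<close>.
\<close>

type_synonym cst = "complex poly poly"

definition var_s :: cst where "var_s = [:0, 1:]"

definition var_t :: cst where "var_t = [:[:0, 1:]:]"

definition shift_s :: "int \<Rightarrow> cst \<Rightarrow> cst"
  where "shift_s n f = pcompose f (var_s - of_int n)"

definition deriv_t :: "cst \<Rightarrow> cst"
  where "deriv_t f = map_poly pderiv f"

text \<open>The division in \<open>H(t) = (h(t) - h(\<alpha>)) / (t - \<alpha>)\<close> is exact, see \<open>H_poly_mult\<close>.\<close>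

definition H_poly :: "complex \<Rightarrow> complex poly \<Rightarrow> complex poly"
  where "H_poly \<alpha> h = (h - [:poly h \<alpha>:]) div [:- \<alpha>, 1:]"

lemma H_poly_mult: "H_poly \<alpha> h * [:- \<alpha>, 1:] = h - [:poly h \<alpha>:]"
  unfolding H_poly_def by (rule dvd_div_mult_self) (simp add: poly_eq_0_iff_dvd[symmetric])

definition h_sub :: "complex \<Rightarrow> complex poly \<Rightarrow> int \<Rightarrow> complex poly"
  where "h_sub \<alpha> h n = smult (of_int n) h - smult (of_int (n * (n - 1)) * \<alpha>) (H_poly \<alpha> h)"

fun Phi_basis ::
  "complex \<Rightarrow> complex \<Rightarrow> complex \<Rightarrow> complex \<Rightarrow> complex poly \<Rightarrow> bms_basis \<Rightarrow> cst \<Rightarrow> cst" where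
  "Phi_basis lam \<alpha> \<beta> \<gamma> h (bL n) f =
     (lam powi n) *\<^sub>C ((var_s + [:h_sub \<alpha> h n:]) * shift_s n f)
     - (of_int n * lam powi n) *\<^sub>C ((var_t - [:[:of_int n * \<alpha>:]:]) * deriv_t (shift_s n f))"
| "Phi_basis lam \<alpha> \<beta> \<gamma> h (bW n) f =
     (lam powi n) *\<^sub>C ((var_t - [:[:of_int n * \<alpha>:]:]) * shift_s n f)"
| "Phi_basis lam \<alpha> \<beta> \<gamma> h (bI n) f =
     (lam powi n) *\<^sub>C ([:[:\<gamma>:] - smult (of_int n * \<beta>) (H_poly \<alpha> h):] * shift_s n f)
     + (of_int n * lam powi n * \<beta>) *\<^sub>C deriv_t (shift_s n f)"
| "Phi_basis lam \<alpha> \<beta> \<gamma> h (bJ n) f = (lam powi n * \<beta>) *\<^sub>C shift_s n f"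

definition Phi ::
  "complex \<Rightarrow> complex \<Rightarrow> complex \<Rightarrow> complex \<Rightarrow> complex poly \<Rightarrow> bms \<Rightarrow> cst \<Rightarrow> cst"
  where "Phi lam \<alpha> \<beta> \<gamma> h x f = free_ext (\<lambda>b. Phi_basis lam \<alpha> \<beta> \<gamma> h b f) x"

definition multilinear :: "(('i \<Rightarrow> 'a::complex_vector) \<Rightarrow> 'b::complex_vector) \<Rightarrow> bool"
  where "multilinear F \<longleftrightarrow> (\<forall>f i. clinear (\<lambda>x. F (f(i := x))))"

inductive_set mtensor_rels :: "(('i \<Rightarrow> 'a::complex_vector) \<Rightarrow>\<^sub>0 complex) set" where
  "free_gen (f(i := x + y)) - (free_gen (f(i := x)) + free_gen (f(i := y))) \<in> mtensor_rels"
| "free_gen (f(i := c *\<^sub>C x)) - c *\<^sub>C free_gen (f(i := x)) \<in> mtensor_rels"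

definition mtensor_rel ::
  "(('i \<Rightarrow> 'a::complex_vector) \<Rightarrow>\<^sub>0 complex) \<Rightarrow> (('i \<Rightarrow> 'a) \<Rightarrow>\<^sub>0 complex) \<Rightarrow> bool"
  where "mtensor_rel u v \<longleftrightarrow> u - v \<in> complex_vector.span mtensor_rels"

lemma equivp_diff_span:
  "equivp (\<lambda>u v. u - v \<in> complex_vector.span (S :: 'a::complex_vector set))"
proof (rule equivpI)
  show "reflp (\<lambda>u v. u - v \<in> complex_vector.span S)"
    by (rule reflpI) (simp add: complex_vector.span_zero)
  show "symp (\<lambda>u v. u - v \<in> complex_vector.span S)"
    by (rule sympI) (metis complex_vector.span_neg minus_diff_eq)
  show "transp (\<lambda>u v. u - v \<in> complex_vector.span S)"
    by (rule transpI) (metis complex_vector.span_add diff_add_cancel add_diff_eq)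
qed

lemma span_diff_add:
  fixes S :: "'a::complex_vector set"
  assumes "u - u' \<in> complex_vector.span S" "v - v' \<in> complex_vector.span S"
  shows "(u + v) - (u' + v') \<in> complex_vector.span S"
    and "(u - v) - (u' - v') \<in> complex_vector.span S"
    and "(- v) - (- v') \<in> complex_vector.span S"
    and "c *\<^sub>C u - c *\<^sub>C u' \<in> complex_vector.span S"
  using complex_vector.span_add[OF assms] complex_vector.span_diff[OF assms]
    complex_vector.span_neg[OF assms(2)] complex_vector.span_scale[OF assms(1), of c]
  by (simp_all add: algebra_simps complex_vector.scale_right_diff_distrib)

text \<open>
  \<open>('i, 'a) mtensor\<close> is the tensor product of copies of the vector space \<open>'a\<close> indexed by the
  type \<open>'i\<close>: the free vector space on \<open>'i \<Rightarrow> 'a\<close> modulo the multilinearity relations.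
\<close>

quotient_type (overloaded) ('i, 'a) mtensor = "('i \<Rightarrow> 'a::complex_vector) \<Rightarrow>\<^sub>0 complex" / mtensor_rel
  unfolding mtensor_rel_def by (rule equivp_diff_span)

instantiation mtensor :: (type, complex_vector) complex_vector
begin
lift_definition zero_mtensor :: "('a, 'b) mtensor" is 0 .
lift_definition plus_mtensor :: "('a, 'b) mtensor \<Rightarrow> ('a, 'b) mtensor \<Rightarrow> ('a, 'b) mtensor" is "(+)"
  unfolding mtensor_rel_def by (rule span_diff_add)
lift_definition minus_mtensor :: "('a, 'b) mtensor \<Rightarrow> ('a, 'b) mtensor \<Rightarrow> ('a, 'b) mtensor" is "(-)"
  unfolding mtensor_rel_def by (rule span_diff_add)
lift_definition uminus_mtensor :: "('a, 'b) mtensor \<Rightarrow> ('a, 'b) mtensor" is uminus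
  unfolding mtensor_rel_def by (rule span_diff_add)
lift_definition scaleC_mtensor :: "complex \<Rightarrow> ('a, 'b) mtensor \<Rightarrow> ('a, 'b) mtensor" is scaleC
  unfolding mtensor_rel_def by (rule span_diff_add)
instance
  by standard
    (transfer, simp add: mtensor_rel_def complex_vector.span_zero algebra_simps
      scaleC_add_right scaleC_add_left scaleC_scaleC scaleC_one)+
end

lift_definition mpure :: "('i \<Rightarrow> 'a::complex_vector) \<Rightarrow> ('i, 'a) mtensor" is free_gen .

text \<open>
  For multilinear \<open>F\<close> the linear map below exists and is unique (\<open>ex1_mtensor_lift\<close>).
\<close>

definition mtensor_lift ::
  "(('i \<Rightarrow> 'a::complex_vector) \<Rightarrow> 'b::complex_vector) \<Rightarrow> ('i, 'a) mtensor \<Rightarrow> 'b"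
  where "mtensor_lift F = (THE g. clinear g \<and> (\<forall>f. g (mpure f) = F f))"

lemma multilinear_mpure: "multilinear mpure"
  unfolding multilinear_def
  by (intro allI clinearI; transfer)
    (auto simp: mtensor_rel_def intro!: complex_vector.span_base mtensor_rels.intros)

lemma abs_mtensor_eq: "abs_mtensor u = free_ext mpure u"
proof -
  have lin: "clinear abs_mtensor"
    by (rule clinearI) (simp_all add: plus_mtensor.abs_eq scaleC_mtensor.abs_eq)
  have "abs_mtensor (\<Sum>x\<in>S. c x *\<^sub>C free_gen x) = (\<Sum>x\<in>S. c x *\<^sub>C mpure x)" if "finite S"
    for S and c :: "('a \<Rightarrow> 'b) \<Rightarrow> complex"
    using that by induction
      (simp_all add: clinear_0[OF lin] clinear_add[OF lin] clinear_scale[OF lin] mpure.abs_eq)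
  then show ?thesis
    by (subst free_decompose) (simp add: free_ext_def)
qed

lemma mtensor_eq_free_ext: "\<exists>u. x = free_ext mpure u"
  by (metis abs_mtensor_eq Quotient3_abs_rep[OF Quotient3_mtensor])

lemma clinear_free_ext_comp:
  assumes "clinear g"
  shows "g (free_ext p u) = free_ext (\<lambda>x. g (p x)) u"
proof -
  have "g (\<Sum>x\<in>S. c x *\<^sub>C p x) = (\<Sum>x\<in>S. c x *\<^sub>C g (p x))" if "finite S" for S c
    using that by induction
      (simp_all add: clinear_0[OF assms] clinear_add[OF assms] clinear_scale[OF assms])
  then show ?thesis by (simp add: free_ext_def)
qed

lemma ex1_mtensor_lift:
  fixes F :: "('i \<Rightarrow> 'a::complex_vector) \<Rightarrow> 'b::complex_vector"
  assumes "multilinear F"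
  shows "\<exists>!g. clinear g \<and> (\<forall>f. g (mpure f) = F f)"
proof -
  define G where "G = free_ext F"
  have G: "clinear G" unfolding G_def by (rule clinear_free_ext)
  have F: "clinear (\<lambda>x. F (f(i := x)))" for f i
    using assms by (simp add: multilinear_def)
  have zero: "G u = 0" if "u \<in> mtensor_rels" for u
    using that
    by cases (simp_all add: clinear_diff[OF G] clinear_add[OF G] clinear_scale[OF G],
      simp_all add: G_def clinear_add[OF F] clinear_scale[OF F])
  have zero': "G u = 0" if "u \<in> complex_vector.span mtensor_rels" for u
    using that
    by (induction rule: complex_vector.span_induct)
      (auto simp: zero complex_vector.subspace_def clinear_0[OF G] clinear_add[OF G] clinear_scale[OF G])
  have resp: "G u = G v" if "mtensor_rel u v" for u v
    using zero'[of "u - v"] that by (simp add: mtensor_rel_def clinear_diff[OF G])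
  define g where "g x = G (rep_mtensor x)" for x
  have g_abs: "g (abs_mtensor u) = G u" for u
    unfolding g_def by (rule resp) (rule Quotient3_rep_abs[OF Quotient3_mtensor], simp add: mtensor_rel_def complex_vector.span_zero)
  have "clinear g"
  proof (rule clinearI)
    fix x y :: "('i, 'a) mtensor" and c
    obtain u v where "x = abs_mtensor u" "y = abs_mtensor v"
      by (metis Quotient3_abs_rep[OF Quotient3_mtensor])
    then show "g (x + y) = g x + g y" "g (c *\<^sub>C x) = c *\<^sub>C g x"
      by (simp_all add: plus_mtensor.abs_eq scaleC_mtensor.abs_eq g_abs clinear_add[OF G] clinear_scale[OF G])
  qed
  moreover have "g (mpure f) = F f" for f
    by (simp add: mpure.abs_eq g_abs) (simp add: G_def)
  moreover have "g' = g''" if "clinear g'" "clinear g''" "\<forall>f. g' (mpure f) = g'' (mpure f)"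
    for g' g'' :: "('i, 'a) mtensor \<Rightarrow> 'b"
  proof
    fix x :: "('i, 'a) mtensor"
    obtain u where "x = free_ext mpure u" using mtensor_eq_free_ext by blast
    then show "g' x = g'' x" using that by (simp add: clinear_free_ext_comp)
  qed
  ultimately show ?thesis by (intro ex1I[of _ g]) auto
qed

lemma
  assumes "multilinear F"
  shows clinear_mtensor_lift: "clinear (mtensor_lift F)"
    and mtensor_lift_mpure: "mtensor_lift F (mpure f) = F f"
  unfolding mtensor_lift_def using theI'[OF ex1_mtensor_lift[OF assms]] by blast+

definition bilinear2 ::
  "('a::complex_vector \<Rightarrow> 'b::complex_vector \<Rightarrow> 'c::complex_vector) \<Rightarrow> bool"
  where "bilinear2 F \<longleftrightarrow> (\<forall>a. clinear (F a)) \<and> (\<forall>b. clinear (\<lambda>a. F a b))"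

inductive_set tensor_rels :: "(('a::complex_vector \<times> 'b::complex_vector) \<Rightarrow>\<^sub>0 complex) set" where
  "free_gen (a + a', b) - (free_gen (a, b) + free_gen (a', b)) \<in> tensor_rels"
| "free_gen (a, b + b') - (free_gen (a, b) + free_gen (a, b')) \<in> tensor_rels"
| "free_gen (c *\<^sub>C a, b) - c *\<^sub>C free_gen (a, b) \<in> tensor_rels"
| "free_gen (a, c *\<^sub>C b) - c *\<^sub>C free_gen (a, b) \<in> tensor_rels"

definition tensor_rel ::
  "(('a::complex_vector \<times> 'b::complex_vector) \<Rightarrow>\<^sub>0 complex) \<Rightarrow> ('a \<times> 'b \<Rightarrow>\<^sub>0 complex) \<Rightarrow> bool"
  where "tensor_rel u v \<longleftrightarrow> u - v \<in> complex_vector.span tensor_rels"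

quotient_type (overloaded) ('a, 'b) tensor =
  "('a::complex_vector \<times> 'b::complex_vector) \<Rightarrow>\<^sub>0 complex" / tensor_rel
  unfolding tensor_rel_def by (rule equivp_diff_span)

instantiation tensor :: (complex_vector, complex_vector) complex_vector
begin
lift_definition zero_tensor :: "('a, 'b) tensor" is 0 .
lift_definition plus_tensor :: "('a, 'b) tensor \<Rightarrow> ('a, 'b) tensor \<Rightarrow> ('a, 'b) tensor" is "(+)"
  unfolding tensor_rel_def by (rule span_diff_add)
lift_definition minus_tensor :: "('a, 'b) tensor \<Rightarrow> ('a, 'b) tensor \<Rightarrow> ('a, 'b) tensor" is "(-)"
  unfolding tensor_rel_def by (rule span_diff_add)
lift_definition uminus_tensor :: "('a, 'b) tensor \<Rightarrow> ('a, 'b) tensor" is uminus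
  unfolding tensor_rel_def by (rule span_diff_add)
lift_definition scaleC_tensor :: "complex \<Rightarrow> ('a, 'b) tensor \<Rightarrow> ('a, 'b) tensor" is scaleC
  unfolding tensor_rel_def by (rule span_diff_add)
instance
  by standard
    (transfer, simp add: tensor_rel_def complex_vector.span_zero algebra_simps
      scaleC_add_right scaleC_add_left scaleC_scaleC scaleC_one)+
end

lift_definition pure :: "'a::complex_vector \<Rightarrow> 'b::complex_vector \<Rightarrow> ('a, 'b) tensor"  (infixr \<open>\<otimes>\<^sub>C\<close> 70)
  is "\<lambda>a b. free_gen (a, b)" .

text \<open>
  For bilinear \<open>F\<close> the linear map below exists and is unique (\<open>ex1_tensor_lift\<close>).
\<close>

definition tensor_lift ::
  "('a::complex_vector \<Rightarrow> 'b::complex_vector \<Rightarrow> 'c::complex_vector) \<Rightarrow> ('a, 'b) tensor \<Rightarrow> 'c"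
  where "tensor_lift F = (THE g. clinear g \<and> (\<forall>a b. g (a \<otimes>\<^sub>C b) = F a b))"

lemma bilinear2_pure: "bilinear2 (\<otimes>\<^sub>C)"
  unfolding bilinear2_def
  by (intro conjI allI clinearI; transfer)
    (auto simp: tensor_rel_def intro!: complex_vector.span_base tensor_rels.intros)

lemma abs_tensor_eq: "abs_tensor u = free_ext (\<lambda>(a, b). a \<otimes>\<^sub>C b) u"
proof -
  have lin: "clinear abs_tensor"
    by (rule clinearI) (simp_all add: plus_tensor.abs_eq scaleC_tensor.abs_eq)
  show ?thesis
    by (subst free_decompose)
      (simp add: clinear_free_ext_comp[OF lin] case_prod_unfold pure.abs_eq)
qed

lemma ex1_tensor_lift:
  fixes F :: "'a::complex_vector \<Rightarrow> 'b::complex_vector \<Rightarrow> 'c::complex_vector"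
  assumes "bilinear2 F"
  shows "\<exists>!g. clinear g \<and> (\<forall>a b. g (a \<otimes>\<^sub>C b) = F a b)"
proof -
  define G where "G = free_ext (\<lambda>(a, b). F a b)"
  have G: "clinear G" unfolding G_def by (rule clinear_free_ext)
  have F: "clinear (F a)" "clinear (\<lambda>a. F a b)" for a b
    using assms by (simp_all add: bilinear2_def)
  have zero: "G u = 0" if "u \<in> tensor_rels" for u
    using that
    by cases (simp_all add: clinear_diff[OF G] clinear_add[OF G] clinear_scale[OF G],
      simp_all add: G_def clinear_add[OF F(1)] clinear_scale[OF F(1)] clinear_add[OF F(2)] clinear_scale[OF F(2)])
  have zero': "G u = 0" if "u \<in> complex_vector.span tensor_rels" for u
    using that
    by (induction rule: complex_vector.span_induct)
      (auto simp: zero complex_vector.subspace_def clinear_0[OF G] clinear_add[OF G] clinear_scale[OF G])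
  have resp: "G u = G v" if "tensor_rel u v" for u v
    using zero'[of "u - v"] that by (simp add: tensor_rel_def clinear_diff[OF G])
  define g where "g x = G (rep_tensor x)" for x
  have g_abs: "g (abs_tensor u) = G u" for u
    unfolding g_def by (rule resp) (rule Quotient3_rep_abs[OF Quotient3_tensor], simp add: tensor_rel_def complex_vector.span_zero)
  have "clinear g"
  proof (rule clinearI)
    fix x y :: "('a, 'b) tensor" and c
    obtain u v where "x = abs_tensor u" "y = abs_tensor v"
      by (metis Quotient3_abs_rep[OF Quotient3_tensor])
    then show "g (x + y) = g x + g y" "g (c *\<^sub>C x) = c *\<^sub>C g x"
      by (simp_all add: plus_tensor.abs_eq scaleC_tensor.abs_eq g_abs clinear_add[OF G] clinear_scale[OF G])
  qed
  moreover have "g (a \<otimes>\<^sub>C b) = F a b" for a b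
    by (simp add: pure.abs_eq g_abs) (simp add: G_def)
  moreover have "g' = g''"
    if "clinear g'" "clinear g''" "\<forall>a b. g' (a \<otimes>\<^sub>C b) = g'' (a \<otimes>\<^sub>C b)"
    for g' g'' :: "('a, 'b) tensor \<Rightarrow> 'c"
  proof
    fix x :: "('a, 'b) tensor"
    obtain u where "x = free_ext (\<lambda>(a, b). a \<otimes>\<^sub>C b) u"
      by (metis abs_tensor_eq Quotient3_abs_rep[OF Quotient3_tensor])
    then show "g' x = g'' x" using that by (simp add: clinear_free_ext_comp case_prod_unfold)
  qed
  ultimately show ?thesis by (intro ex1I[of _ g]) auto
qed

lemma
  assumes "bilinear2 F"
  shows clinear_tensor_lift: "clinear (tensor_lift F)"
    and tensor_lift_pure: "tensor_lift F (a \<otimes>\<^sub>C b) = F a b"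
  unfolding tensor_lift_def using theI'[OF ex1_tensor_lift[OF assms]] by blast+

definition mtensor_act ::
  "('i::finite \<Rightarrow> bms \<Rightarrow> 'a::complex_vector \<Rightarrow> 'a) \<Rightarrow> bms \<Rightarrow> ('i, 'a) mtensor \<Rightarrow> ('i, 'a) mtensor"
  where "mtensor_act \<rho> x = mtensor_lift (\<lambda>f. \<Sum>i\<in>UNIV. mpure (f(i := \<rho> i x (f i))))"

definition tensor_act ::
  "(bms \<Rightarrow> 'a::complex_vector \<Rightarrow> 'a) \<Rightarrow> (bms \<Rightarrow> 'b::complex_vector \<Rightarrow> 'b) \<Rightarrow>
    bms \<Rightarrow> ('a, 'b) tensor \<Rightarrow> ('a, 'b) tensor"
  where "tensor_act \<rho> \<sigma> x = tensor_lift (\<lambda>a b. \<rho> x a \<otimes>\<^sub>C b + a \<otimes>\<^sub>C \<sigma> x b)"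

lemma mtensor_act_mpure:
  fixes \<rho> :: "'i::finite \<Rightarrow> bms \<Rightarrow> 'a::complex_vector \<Rightarrow> 'a"
  assumes "\<And>i. bms_module (\<rho> i)"
  shows "mtensor_act \<rho> x (mpure f) = (\<Sum>i\<in>UNIV. mpure (f(i := \<rho> i x (f i))))"
  unfolding mtensor_act_def
proof (rule mtensor_lift_mpure)
  have \<rho>: "clinear (\<rho> i x)" for i
    using assms by (simp add: bms_module_def)
  have pure: "clinear (\<lambda>y. mpure (f(i := y)))" for f :: "'i \<Rightarrow> 'a" and i
    by (rule multilinear_mpure[unfolded multilinear_def, rule_format])
  have lin: "clinear (\<lambda>y. mpure ((f(j := y))(i := \<rho> i x ((f(j := y)) i))))" (is "clinear ?g")
    for f i j
  proof (cases "i = j")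
    case True
    then show ?thesis
      by (intro clinearI) (simp_all add: clinear_add[OF \<rho>] clinear_scale[OF \<rho>] clinear_add[OF pure] clinear_scale[OF pure])
  next
    case False
    then have "?g = (\<lambda>y. mpure ((f(i := \<rho> i x (f i)))(j := y)))"
      by (simp add: fun_upd_twist)
    then show ?thesis using pure by simp
  qed
  show "multilinear (\<lambda>f. \<Sum>i\<in>UNIV. mpure (f(i := \<rho> i x (f i))))"
    unfolding multilinear_def
    by (intro allI clinearI)
      (simp_all add: clinear_add[OF lin] clinear_scale[OF lin] sum.distrib complex_vector.scale_sum_right del: fun_upd_apply)
qed

lemma tensor_act_pure:
  fixes \<rho> :: "bms \<Rightarrow> 'a::complex_vector \<Rightarrow> 'a" and \<sigma> :: "bms \<Rightarrow> 'b::complex_vector \<Rightarrow> 'b"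
  assumes "bms_module \<rho>" "bms_module \<sigma>"
  shows "tensor_act \<rho> \<sigma> x (a \<otimes>\<^sub>C b) = \<rho> x a \<otimes>\<^sub>C b + a \<otimes>\<^sub>C \<sigma> x b"
  unfolding tensor_act_def
proof (rule tensor_lift_pure)
  have lin: "clinear (\<rho> x)" "clinear (\<sigma> x)"
    using assms by (simp_all add: bms_module_def)
  have pure: "clinear (\<lambda>b. a \<otimes>\<^sub>C b)" "clinear (\<lambda>a. a \<otimes>\<^sub>C b)" for a :: 'a and b :: 'b
    by (rule bilinear2_pure[unfolded bilinear2_def, THEN conjunct1, rule_format],
      rule bilinear2_pure[unfolded bilinear2_def, THEN conjunct2, rule_format])
  note simps = clinear_add[OF lin(1)] clinear_add[OF lin(2)] clinear_scale[OF lin(1)]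
    clinear_scale[OF lin(2)] clinear_add[OF pure(1)] clinear_add[OF pure(2)]
    clinear_scale[OF pure(1)] clinear_scale[OF pure(2)]
  show "bilinear2 (\<lambda>a b. \<rho> x a \<otimes>\<^sub>C b + a \<otimes>\<^sub>C \<sigma> x b)"
    unfolding bilinear2_def
    by (intro conjI allI clinearI) (simp_all add: simps scaleC_add_right algebra_simps)
qed

end

theory Submission
  imports Defs
begin

text \<open>
  Let \<open>u\<close> be in a nonzero submodule \<open>N\<close>. For large \<open>n\<close> the factor \<open>V\<close> is annihilated, so
  \<open>X\<^sub>n u\<close> for \<open>X = L, W, I, J\<close> is a sum over \<open>i\<close> of \<open>\<lambda>\<^sub>i\<^sup>n\<close> times a polynomial in \<open>n\<close> with vector
  coefficients. As the \<open>\<lambda>\<^sub>i\<close> are distinct, exponential polynomials in \<open>n\<close> are independent and every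
  coefficient lies in \<open>N\<close>. These coefficients show that \<open>N\<close> is stable under the Weyl algebra
  generated by \<open>s\<^sub>i\<close>, \<open>t\<^sub>i\<close> and the partial derivatives with respect to them. The derivatives are commuting and
  locally nilpotent, so \<open>N\<close> contains some \<open>1 \<otimes> v\<close> with \<open>v \<noteq> 0\<close>. The vectors \<open>v\<close> with
  \<open>1 \<otimes> v \<in> N\<close> form a submodule of \<open>V\<close>, hence all of \<open>V\<close>; multiplying by polynomials then fills
  the whole tensor product.
\<close>

section \<open>Exponential polynomials\<close>

text \<open>Induction on \<open>S\<close>, and inside it on the degree of the polynomial
  \<open>p j\<close> of the new index. Subtracting \<open>lam j\<close> times the relation at
  \<open>n\<close> from the relation at \<open>n + 1\<close> gives a relation of the same kind. It
  lowers the degree of \<open>p j\<close>, and for the other indices it multiplies the leading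
  coefficient of \<open>p i\<close> by \<open>lam i - lam j\<close>, which is nonzero by
  injectivity.\<close>

lemma exp_poly_independent:
  fixes lam :: "'i \<Rightarrow> complex" and p :: "'i \<Rightarrow> complex poly"
  assumes "finite S" "inj_on lam S" "\<And>i. i \<in> S \<Longrightarrow> lam i \<noteq> 0"
    and "\<And>n. n \<ge> K \<Longrightarrow> (\<Sum>i\<in>S. lam i ^ n * poly (p i) (of_nat n)) = 0"
    and "i \<in> S"
  shows "p i = 0"
  using assms
proof (induction S arbitrary: p i rule: finite_induct)
  case empty
  then show ?case by simp
next
  case (insert j S)
  have eventually_zero: "q = 0" if "\<And>n. n \<ge> K \<Longrightarrow> poly q (of_nat n) = 0" for q :: "complex poly"
  proof (rule ccontr)
    assume "q \<noteq> 0"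
    then have "finite {x. poly q x = 0}" by (rule poly_roots_finite)
    moreover have "of_nat ` {K..} \<subseteq> {x. poly q x = 0}" using that by auto
    ultimately have "finite (of_nat ` {K..} :: complex set)" by (rule finite_subset[rotated])
    then have "finite {K..}" by (rule finite_imageD) (simp add: inj_on_def)
    then show False by (simp add: infinite_Ici)
  qed
  have "\<forall>i \<in> insert j S. p i = 0"
    using insert.prems(3)
  proof (induction "degree (p j)" arbitrary: p rule: less_induct)
    case less
    define q where "q i = smult (lam i) (pcompose (p i) [:1, 1:]) - smult (lam j) (p i)" for i
    have sum_q: "(\<Sum>i\<in>insert j S. lam i ^ n * poly (q i) (of_nat n)) = 0" if "n \<ge> K" for n
    proof -
      have "(\<Sum>i\<in>insert j S. lam i ^ n * poly (q i) (of_nat n)) =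
        (\<Sum>i\<in>insert j S. lam i ^ Suc n * poly (p i) (of_nat (Suc n)))
        - lam j * (\<Sum>i\<in>insert j S. lam i ^ n * poly (p i) (of_nat n))"
        by (simp only: sum_distrib_left sum_subtractf[symmetric])
          (rule sum.cong, auto simp: q_def poly_pcompose algebra_simps)
      then show ?thesis using less.prems[of n] less.prems[of "Suc n"] that by simp
    qed
    have lead: "coeff (pcompose f [:1, 1:]) (degree f) = lead_coeff f" for f :: "complex poly"
      using lead_coeff_comp[of "[:1, 1:]" f] degree_pcompose[of f "[:1, 1:]"] by simp
    \<comment> \<open>If \<open>p j\<close> is constant, then \<open>q j\<close> vanishes and the
      outer hypothesis applies to \<open>S\<close> alone. Otherwise the degree of \<open>q j\<close>
      is smaller and the inner hypothesis applies.\<close>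
    have "q i = 0" if "i \<in> S" for i
    proof (cases "degree (p j) = 0")
      case True
      then have "q j = 0" by (auto simp: q_def elim!: degree_eq_zeroE)
      then have "(\<Sum>i\<in>S. lam i ^ n * poly (q i) (of_nat n)) = 0" if "n \<ge> K" for n
        using sum_q[OF that] insert.hyps by simp
      then show ?thesis
        using insert.IH[of q i] insert.prems that by auto
    next
      case False
      have "degree (q j) \<le> degree (p j)"
        unfolding q_def by (intro degree_diff_le order.trans[OF degree_smult_le])
        (simp_all add: degree_pcompose)
      moreover have "coeff (q j) (degree (p j)) = 0" by (simp add: q_def lead)
      ultimately have "degree (q j) < degree (p j)"
        using False by (metis leading_coeff_0_iff degree_0 le_neq_implies_less neq0_conv)
      then show ?thesis using less.hyps[of q] sum_q that by auto
    qed
    moreover have "p i = 0" if "i \<in> S" "q i = 0" for i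
    proof -
      have "lam i \<noteq> lam j" using that insert.prems(1) insert.hyps by (auto simp: image_iff)
      moreover have "coeff (q i) (degree (p i)) = (lam i - lam j) * lead_coeff (p i)"
        by (simp add: q_def lead algebra_simps)
      ultimately show ?thesis using that by simp
    qed
    ultimately have S: "p i = 0" if "i \<in> S" for i using that by blast
    have "lam j ^ n * poly (p j) (of_nat n) = 0" if "n \<ge> K" for n
      using less.prems[OF that] insert.hyps by (simp add: S)
    then have "p j = 0" using insert.prems(2)[of j] by (intro eventually_zero) auto
    with S show ?case by blast
  qed
  with insert.prems(4) show ?case by blast
qed

text \<open>A basis of \<open>N\<close> stays independent when \<open>w\<close> is adjoined, so the
  values of a functional may be prescribed there. This reduces statements on vector coefficients to
  scalar ones.\<close>

lemma subspace_separation: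
  fixes N :: "'a::complex_vector set"
  assumes "complex_vector.subspace N" "w \<notin> N"
  obtains \<phi> :: "'a \<Rightarrow> complex" where "clinear \<phi>" "\<phi> w = 1" "\<And>x. x \<in> N \<Longrightarrow> \<phi> x = 0"
proof -
  interpret vector_space_pair "scaleC :: complex \<Rightarrow> 'a \<Rightarrow> 'a" "scaleC :: complex \<Rightarrow> complex \<Rightarrow> complex"
    by standard
  obtain B where B: "B \<subseteq> N" "complex_vector.independent B" "N \<subseteq> complex_vector.span B"
    using complex_vector.maximal_independent_subset by blast
  have span: "complex_vector.span B = N"
    using B assms complex_vector.span_minimal by blast
  then have "complex_vector.independent (insert w B)"
    using B assms by (simp add: complex_vector.independent_insertI)
  from linear_independent_extend[OF this, of "\<lambda>x. if x = w then 1 else 0"]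
  obtain \<phi> :: "'a \<Rightarrow> complex"
    where \<phi>: "clinear \<phi>" "\<And>x. x \<in> insert w B \<Longrightarrow> \<phi> x = (if x = w then 1 else 0)"
    by (elim exE conjE) (simp only: Ball_def)
  have "complex_vector.span B \<subseteq> {x. \<phi> x = 0}"
    using B(1) assms(2) \<phi>(2)
    by (intro complex_vector.span_minimal)
      (auto simp: complex_vector.subspace_def clinear_0[OF \<phi>(1)] clinear_add[OF \<phi>(1)]
          clinear_scale[OF \<phi>(1)] scaleC_complex_def)
  with that[of \<phi>] \<phi> span show thesis by auto
qed

lemma clinear_sum: "clinear f \<Longrightarrow> f (\<Sum>x\<in>S. g x) = (\<Sum>x\<in>S. f (g x))"
  by (induction S rule: infinite_finite_induct) (simp_all add: clinear_0 clinear_add)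

text \<open>A functional that vanishes on \<open>N\<close> but not on an offending coefficient would
  turn the memberships into a scalar exponential relation with a nonzero coefficient.\<close>

lemma exp_poly_coeff_mem:
  fixes w :: "'i \<Rightarrow> nat \<Rightarrow> 'a::complex_vector" and lam :: "'i \<Rightarrow> complex"
  assumes "complex_vector.subspace N" "finite S" "inj_on lam S" "\<And>i. i \<in> S \<Longrightarrow> lam i \<noteq> 0"
    and mem: "\<And>n. n \<ge> K \<Longrightarrow> (\<Sum>i\<in>S. \<Sum>r\<le>d. (lam i ^ n * of_nat n ^ r) *\<^sub>C w i r) \<in> N"
    and "i \<in> S" "r \<le> d"
  shows "w i r \<in> N"
proof (rule ccontr)
  assume "w i r \<notin> N"
  from subspace_separation[OF assms(1) this] obtain \<phi> :: "'a \<Rightarrow> complex"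
    where \<phi>: "clinear \<phi>" "\<phi> (w i r) = 1" "\<And>x. x \<in> N \<Longrightarrow> \<phi> x = 0" by blast
  define p where "p i = (\<Sum>r\<le>d. monom (\<phi> (w i r)) r)" for i
  have "(\<Sum>i\<in>S. lam i ^ n * poly (p i) (of_nat n)) = 0" if "n \<ge> K" for n
    using \<phi>(3)[OF mem[OF that]]
    by (simp add: p_def clinear_sum[OF \<phi>(1)] clinear_scale[OF \<phi>(1)] scaleC_complex_def
        poly_sum poly_monom sum_distrib_left mult_ac)
  with assms(2-4) have "p i = 0" using assms(6) by (rule exp_poly_independent)
  then have "coeff (p i) r = 0" by simp
  moreover have "coeff (p i) r = \<phi> (w i r)"
    using \<open>r \<le> d\<close> by (simp add: p_def coeff_sum)
  ultimately show False using \<phi>(2) by simp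
qed
section \<open>Operators on tensor products\<close>

lemma clinear_compose: "clinear f \<Longrightarrow> clinear g \<Longrightarrow> clinear (\<lambda>x. f (g x))"
  by (intro clinearI) (simp_all add: clinear_add clinear_scale)

lemma clinear_id: "clinear (\<lambda>x. x)"
  and clinear_zero: "clinear (\<lambda>x. 0)"
  by (simp_all add: clinearI)

lemma clinear_plus: "clinear f \<Longrightarrow> clinear g \<Longrightarrow> clinear (\<lambda>x. f x + g x)"
  and clinear_minus: "clinear f \<Longrightarrow> clinear g \<Longrightarrow> clinear (\<lambda>x. f x - g x)"
  and clinear_scaled: "clinear f \<Longrightarrow> clinear (\<lambda>x. c *\<^sub>C f x)"
  by (intro clinearI; simp add: clinear_add clinear_scale scaleC_add_right scaleC_scaleC mult.commute
      complex_vector.scale_right_diff_distrib)+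

lemma clinear_sum_fun: "(\<And>i. i \<in> S \<Longrightarrow> clinear (f i)) \<Longrightarrow> clinear (\<lambda>x. \<Sum>i\<in>S. f i x)"
  by (induction S rule: infinite_finite_induct) (simp_all add: clinear_zero clinear_plus)

lemma clinear_funpow:
  fixes f :: "'a::complex_vector \<Rightarrow> 'a"
  shows "clinear f \<Longrightarrow> clinear (f ^^ k)"
proof (induction k)
  case 0
  then show ?case by (simp add: id_def clinear_id)
next
  case (Suc k)
  then show ?case using clinear_compose[of f "f ^^ k"] by (simp add: comp_def)
qed

lemma clinear_mpure: "clinear (\<lambda>y. mpure (f(i := y)))"
  by (rule multilinear_mpure[unfolded multilinear_def, rule_format])

lemma clinear_pure: "clinear (\<lambda>b. a \<otimes>\<^sub>C b)" "clinear (\<lambda>a. a \<otimes>\<^sub>C b)"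
  by (rule bilinear2_pure[unfolded bilinear2_def, THEN conjunct1, rule_format],
    rule bilinear2_pure[unfolded bilinear2_def, THEN conjunct2, rule_format])

lemma mpure_induct:
  assumes "complex_vector.subspace P" "\<And>f. mpure f \<in> P"
  shows "u \<in> P"
proof -
  obtain w where "u = free_ext mpure w" using mtensor_eq_free_ext by blast
  then show ?thesis
    using assms by (simp add: free_ext_def complex_vector.subspace_sum complex_vector.subspace_scale)
qed

lemma pure_induct:
  assumes "complex_vector.subspace P" "\<And>a b. a \<otimes>\<^sub>C b \<in> P"
  shows "u \<in> P"
proof -
  obtain w where "u = free_ext (\<lambda>(a, b). a \<otimes>\<^sub>C b) w"
    by (metis abs_tensor_eq Quotient3_abs_rep[OF Quotient3_tensor])
  then show ?thesis
    using assms by (simp add: free_ext_def complex_vector.subspace_sum complex_vector.subspace_scale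
        case_prod_unfold)
qed

lemma subspace_clinear_vimage:
  assumes "clinear f" "complex_vector.subspace P"
  shows "complex_vector.subspace {x. f x \<in> P}"
  using assms by (simp add: complex_vector.subspace_def clinear_0 clinear_add clinear_scale)

lemma mpure_pure_induct:
  assumes P: "complex_vector.subspace P" and "\<And>f v. mpure f \<otimes>\<^sub>C v \<in> P"
  shows "u \<in> P"
proof (rule pure_induct[OF P])
  fix a :: "('a, 'b) mtensor" and v :: 'c
  have "a \<in> {a. a \<otimes>\<^sub>C v \<in> P}"
    by (rule mpure_induct[OF subspace_clinear_vimage[OF clinear_pure(2) P]]) (simp add: assms)
  then show "a \<otimes>\<^sub>C v \<in> P" by simp
qed

lemma subspace_equalizer:
  "clinear f \<Longrightarrow> clinear g \<Longrightarrow> complex_vector.subspace {x. f x = g x}"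
  by (simp add: complex_vector.subspace_def clinear_0 clinear_add clinear_scale)

lemma mpure_eqI:
  assumes "clinear f" "clinear g" "\<And>x. f (mpure x) = g (mpure x)"
  shows "f u = g u"
  using mpure_induct[OF subspace_equalizer[OF assms(1,2)], of u] assms(3) by simp

lemma pure_eqI:
  assumes "clinear f" "clinear g" "\<And>a b. f (a \<otimes>\<^sub>C b) = g (a \<otimes>\<^sub>C b)"
  shows "f u = g u"
  using pure_induct[OF subspace_equalizer[OF assms(1,2)], of u] assms(3) by simp

lemma mpure_pure_eqI:
  assumes "clinear f" "clinear g" "\<And>x v. f (mpure x \<otimes>\<^sub>C v) = g (mpure x \<otimes>\<^sub>C v)"
  shows "f u = g u"
  using mpure_pure_induct[OF subspace_equalizer[OF assms(1,2)], of u] assms(3) by simp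

text \<open>The operator \<open>A\<close> on factor \<open>i\<close> tensored with the identity on
  all others. The action on a tensor power is a sum of such operators, which allows computing with
  operators instead of pure tensors.\<close>

definition slot :: "'i \<Rightarrow> ('a \<Rightarrow> 'a) \<Rightarrow> ('i, 'a::complex_vector) mtensor \<Rightarrow> ('i, 'a) mtensor"
  where "slot i A = mtensor_lift (\<lambda>f. mpure (f(i := A (f i))))"

context
  fixes i :: 'i and A :: "'a::complex_vector \<Rightarrow> 'a"
  assumes A: "clinear A"
begin

lemma multilinear_slot: "multilinear (\<lambda>f. mpure (f(i := A (f i))))"
  unfolding multilinear_def
proof (intro allI)
  fix f :: "'i \<Rightarrow> 'a" and j
  show "clinear (\<lambda>x. mpure ((f(j := x))(i := A ((f(j := x)) i))))"
  proof (cases "i = j")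
    case True
    then show ?thesis using clinear_compose[OF clinear_mpure A] by simp
  next
    case False
    then show ?thesis using clinear_mpure[of "f(i := A (f i))" j] by (simp add: fun_upd_twist[of j i])
  qed
qed

lemma clinear_slot: "clinear (slot i A)"
  and slot_mpure: "slot i A (mpure f) = mpure (f(i := A (f i)))"
  unfolding slot_def
  using clinear_mtensor_lift[OF multilinear_slot] mtensor_lift_mpure[OF multilinear_slot] by auto

end

definition tensor_map ::
  "('a \<Rightarrow> 'a) \<Rightarrow> ('b \<Rightarrow> 'b) \<Rightarrow> ('a::complex_vector, 'b::complex_vector) tensor \<Rightarrow> ('a, 'b) tensor"
  where "tensor_map A B = tensor_lift (\<lambda>a b. A a \<otimes>\<^sub>C B b)"

context
  fixes A :: "'a::complex_vector \<Rightarrow> 'a" and B :: "'b::complex_vector \<Rightarrow> 'b"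
  assumes AB: "clinear A" "clinear B"
begin

lemma bilinear2_tensor_map: "bilinear2 (\<lambda>a b. A a \<otimes>\<^sub>C B b)"
  unfolding bilinear2_def
  using clinear_compose[OF clinear_pure(1) AB(2)] clinear_compose[OF clinear_pure(2) AB(1)] by blast

lemma clinear_tensor_map: "clinear (tensor_map A B)"
  and tensor_map_pure: "tensor_map A B (a \<otimes>\<^sub>C b) = A a \<otimes>\<^sub>C B b"
  unfolding tensor_map_def
  using clinear_tensor_lift[OF bilinear2_tensor_map] tensor_lift_pure[OF bilinear2_tensor_map]
  by auto

end

section \<open>The action on tensor products of modules\<close>

lemma mtensor_act_slot:
  fixes \<rho> :: "'i::finite \<Rightarrow> bms \<Rightarrow> 'a::complex_vector \<Rightarrow> 'a"
  assumes "\<And>i. bms_module (\<rho> i)"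
  shows "mtensor_act \<rho> x u = (\<Sum>i\<in>UNIV. slot i (\<rho> i x) u)"
    and "clinear (mtensor_act \<rho> x)"
proof -
  have lin: "clinear (\<rho> i x)" for i using assms by (simp add: bms_module_def)
  have sum: "multilinear (\<lambda>f. \<Sum>i\<in>UNIV. mpure (f(i := \<rho> i x (f i))))"
    unfolding multilinear_def
    by (intro allI clinear_sum_fun multilinear_slot[OF lin, unfolded multilinear_def, rule_format])
  show act: "clinear (mtensor_act \<rho> x)"
    unfolding mtensor_act_def by (rule clinear_mtensor_lift[OF sum])
  show "mtensor_act \<rho> x u = (\<Sum>i\<in>UNIV. slot i (\<rho> i x) u)"
    by (rule mpure_eqI[OF act clinear_sum_fun])
      (simp_all add: clinear_slot lin slot_mpure mtensor_act_mpure assms)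
qed

lemma tensor_act_tensor_map:
  fixes \<rho> :: "bms \<Rightarrow> 'a::complex_vector \<Rightarrow> 'a" and \<sigma> :: "bms \<Rightarrow> 'b::complex_vector \<Rightarrow> 'b"
  assumes "bms_module \<rho>" "bms_module \<sigma>"
  shows "tensor_act \<rho> \<sigma> x u = tensor_map (\<rho> x) (\<lambda>b. b) u + tensor_map (\<lambda>a. a) (\<sigma> x) u"
    and "clinear (tensor_act \<rho> \<sigma> x)"
proof -
  have lin: "clinear (\<rho> x)" "clinear (\<sigma> x)" using assms by (simp_all add: bms_module_def)
  have bil: "bilinear2 (\<lambda>a b. \<rho> x a \<otimes>\<^sub>C b + a \<otimes>\<^sub>C \<sigma> x b)"
    unfolding bilinear2_def
    by (intro conjI allI clinear_plus clinear_pure clinear_compose[OF clinear_pure(1) lin(2)]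
        clinear_compose[OF clinear_pure(2) lin(1)])
  show act: "clinear (tensor_act \<rho> \<sigma> x)"
    unfolding tensor_act_def by (rule clinear_tensor_lift[OF bil])
  show "tensor_act \<rho> \<sigma> x u = tensor_map (\<rho> x) (\<lambda>b. b) u + tensor_map (\<lambda>a. a) (\<sigma> x) u"
    by (rule pure_eqI[OF act clinear_plus])
      (simp_all add: clinear_tensor_map lin clinear_id tensor_map_pure tensor_act_pure assms)
qed

lemma
  assumes A: "clinear A" and B: "clinear B"
  shows slot_add: "slot i (\<lambda>x. A x + B x) u = slot i A u + slot i B u"
    and slot_diff: "slot i (\<lambda>x. A x - B x) u = slot i A u - slot i B u"
    and slot_compose: "slot i (\<lambda>x. A (B x)) u = slot i A (slot i B u)"
  by (rule mpure_eqI; simp add: assms clinear_slot clinear_plus clinear_minus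
      clinear_compose[OF A B] clinear_compose[OF clinear_slot[OF A] clinear_slot[OF B]]
      slot_mpure clinear_add[OF clinear_mpure] clinear_diff[OF clinear_mpure])+

lemma slot_scale: "clinear A \<Longrightarrow> slot i (\<lambda>x. c *\<^sub>C A x) u = c *\<^sub>C slot i A u"
  by (rule mpure_eqI) (simp_all add: clinear_slot clinear_scaled slot_mpure clinear_scale[OF clinear_mpure])

lemma slot_commute:
  assumes A: "clinear A" and B: "clinear B" and "i \<noteq> j"
  shows "slot i A (slot j B u) = slot j B (slot i A u)"
proof (rule mpure_eqI[where f = "\<lambda>u. slot i A (slot j B u)"])
  show "slot i A (slot j B (mpure f)) = slot j B (slot i A (mpure f))" for f
    using \<open>i \<noteq> j\<close> by (simp add: A B slot_mpure fun_upd_twist[of i j])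
qed (rule clinear_compose[OF clinear_slot[OF A] clinear_slot[OF B]]
    clinear_compose[OF clinear_slot[OF B] clinear_slot[OF A]])+

text \<open>In the double sum for the commutator of two actions the operators in different slots
  commute. Only the diagonal terms survive, and these are given by the module relation of each
  factor.\<close>

lemma bms_module_mtensor_act:
  fixes \<rho> :: "'i::finite \<Rightarrow> bms \<Rightarrow> 'a::complex_vector \<Rightarrow> 'a"
  assumes "\<And>i. bms_module (\<rho> i)"
  shows "bms_module (mtensor_act \<rho>)"
proof -
  note act = mtensor_act_slot(1)[of \<rho>, OF assms]
  have lin: "clinear (\<rho> i x)" and lin': "clinear (\<lambda>x. \<rho> i x v)"
    and br: "\<rho> i (bms_bracket x y) = (\<lambda>v. \<rho> i x (\<rho> i y v) - \<rho> i y (\<rho> i x v))" for i x y v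
    using assms[of i] by (auto simp: bms_module_def)
  have add: "\<rho> i (x + y) = (\<lambda>v. \<rho> i x v + \<rho> i y v)"
    and scale: "\<rho> i (c *\<^sub>C x) = (\<lambda>v. c *\<^sub>C \<rho> i x v)" for i x y c
    using clinear_add[OF lin'] clinear_scale[OF lin'] by auto
  have "clinear (\<lambda>x. mtensor_act \<rho> x u)" for u
    unfolding act by (rule clinearI)
      (simp_all add: add scale slot_add slot_scale lin sum.distrib complex_vector.scale_sum_right)
  moreover have "mtensor_act \<rho> (bms_bracket x y) u =
    mtensor_act \<rho> x (mtensor_act \<rho> y u) - mtensor_act \<rho> y (mtensor_act \<rho> x u)" for x y u
  proof -
    have "slot i (\<rho> i x) (slot j (\<rho> j y) u) - slot j (\<rho> j y) (slot i (\<rho> i x) u) =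
      (if i = j then slot i (\<rho> i (bms_bracket x y)) u else 0)" for i j
      by (auto simp: br slot_diff slot_compose lin clinear_compose[OF lin lin] slot_commute)
    then have "(\<Sum>i\<in>UNIV. slot i (\<rho> i (bms_bracket x y)) u) =
      (\<Sum>i\<in>UNIV. \<Sum>j\<in>UNIV. slot i (\<rho> i x) (slot j (\<rho> j y) u) - slot j (\<rho> j y) (slot i (\<rho> i x) u))"
      by (simp)
    also have "\<dots> = (\<Sum>i\<in>UNIV. slot i (\<rho> i x) (\<Sum>j\<in>UNIV. slot j (\<rho> j y) u))
        - (\<Sum>j\<in>UNIV. slot j (\<rho> j y) (\<Sum>i\<in>UNIV. slot i (\<rho> i x) u))"
      using sum.swap[of "\<lambda>i j. slot j (\<rho> j y) (slot i (\<rho> i x) u)" UNIV UNIV]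
      by (simp add: sum_subtractf clinear_sum[OF clinear_slot[OF lin]])
    finally show ?thesis by (simp add: act)
  qed
  ultimately show ?thesis
    using mtensor_act_slot(2)[of \<rho>, OF assms] by (simp add: bms_module_def)
qed

text \<open>On pure tensors the mixed terms, with one element acting on each side, cancel in the
  commutator.\<close>

lemma bms_module_tensor_act:
  fixes \<rho> :: "bms \<Rightarrow> 'a::complex_vector \<Rightarrow> 'a" and \<sigma> :: "bms \<Rightarrow> 'b::complex_vector \<Rightarrow> 'b"
  assumes "bms_module \<rho>" "bms_module \<sigma>"
  shows "bms_module (tensor_act \<rho> \<sigma>)"
proof -
  have lin: "clinear (\<rho> x)" "clinear (\<sigma> x)" for x
    using assms by (simp_all add: bms_module_def)
  have lin': "clinear (\<lambda>x. \<rho> x a)" "clinear (\<lambda>x. \<sigma> x b)" for a b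
    using assms by (simp_all add: bms_module_def)
  note act = tensor_act_tensor_map(2)[OF assms]
  note simps = clinear_add[OF lin'(1)] clinear_add[OF lin'(2)] clinear_scale[OF lin'(1)]
    clinear_scale[OF lin'(2)] tensor_act_pure[OF assms] scaleC_add_right
    clinear_add[OF clinear_pure(1)] clinear_add[OF clinear_pure(2)]
    clinear_scale[OF clinear_pure(1)] clinear_scale[OF clinear_pure(2)]
    clinear_diff[OF clinear_pure(1)] clinear_diff[OF clinear_pure(2)]
  have "tensor_act \<rho> \<sigma> (x + y) u = tensor_act \<rho> \<sigma> x u + tensor_act \<rho> \<sigma> y u" for x y u
    by (rule pure_eqI) (simp_all add: act clinear_plus simps)
  moreover have "tensor_act \<rho> \<sigma> (c *\<^sub>C x) u = c *\<^sub>C tensor_act \<rho> \<sigma> x u" for c x u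
    by (rule pure_eqI) (simp_all add: act clinear_scaled simps)
  moreover have "tensor_act \<rho> \<sigma> (bms_bracket x y) u =
    tensor_act \<rho> \<sigma> x (tensor_act \<rho> \<sigma> y u) - tensor_act \<rho> \<sigma> y (tensor_act \<rho> \<sigma> x u)" for x y u
  proof (rule pure_eqI[where g = "\<lambda>u. tensor_act \<rho> \<sigma> x (tensor_act \<rho> \<sigma> y u) - tensor_act \<rho> \<sigma> y (tensor_act \<rho> \<sigma> x u)"])
    have br: "\<rho> (bms_bracket x y) a = \<rho> x (\<rho> y a) - \<rho> y (\<rho> x a)"
      "\<sigma> (bms_bracket x y) b = \<sigma> x (\<sigma> y b) - \<sigma> y (\<sigma> x b)" for a b
      using assms by (simp_all add: bms_module_def)
    show "tensor_act \<rho> \<sigma> (bms_bracket x y) (a \<otimes>\<^sub>C b) = tensor_act \<rho> \<sigma> x (tensor_act \<rho> \<sigma> y (a \<otimes>\<^sub>C b))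
      - tensor_act \<rho> \<sigma> y (tensor_act \<rho> \<sigma> x (a \<otimes>\<^sub>C b))" for a b
      by (simp add: simps br clinear_add[OF act])
  qed (simp_all add: act clinear_minus clinear_compose[OF act act])
  ultimately show ?thesis
    using act by (auto simp: bms_module_def intro!: clinearI)
qed

section \<open>The modules over polynomials\<close>

text \<open>Makes scalars into constant polynomials, so that identities between operators on
  \<open>cst\<close> become identities in a commutative ring.\<close>

lemma scaleC_cst: "c *\<^sub>C f = [:[:c:]:] * f" for f :: cst
  by (simp add: poly_eq_iff scaleC_poly_def coeff_map_poly scaleC_complex_def)

lemma shift_s_const [simp]: "shift_s n [:p:] = [:p:]"
  and shift_s_var_s [simp]: "shift_s n var_s = var_s - of_int n"
  and shift_s_var_t [simp]: "shift_s n var_t = var_t"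
  and shift_s_of_int [simp]: "shift_s n (of_int m) = of_int m"
  by (simp_all add: shift_s_def var_s_def var_t_def of_int_poly pcompose_pCons)

lemma shift_s_add: "shift_s n (f + g) = shift_s n f + shift_s n g"
  and shift_s_diff: "shift_s n (f - g) = shift_s n f - shift_s n g"
  and shift_s_mult: "shift_s n (f * g) = shift_s n f * shift_s n g"
  by (simp_all add: shift_s_def pcompose_add pcompose_diff pcompose_mult)

lemma shift_s_shift_s: "shift_s m (shift_s n f) = shift_s (m + n) f"
proof -
  have "pcompose (var_s - of_int n) (var_s - of_int m) = (var_s - of_int (m + n) :: cst)"
    by (simp add: var_s_def of_int_poly pcompose_pCons)
  then show ?thesis by (simp add: shift_s_def pcompose_assoc[symmetric])
qed

lemma deriv_t_const [simp]: "deriv_t [:p:] = [:pderiv p:]"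
  and deriv_t_var_s [simp]: "deriv_t var_s = 0"
  and deriv_t_var_t [simp]: "deriv_t var_t = 1"
  and deriv_t_of_int [simp]: "deriv_t (of_int m) = 0"
  by (simp_all add: deriv_t_def var_s_def var_t_def of_int_poly map_poly_pCons pderiv_pCons one_pCons)

lemma deriv_t_add: "deriv_t (f + g) = deriv_t f + deriv_t g"
  and deriv_t_diff: "deriv_t (f - g) = deriv_t f - deriv_t g"
  by (simp_all add: deriv_t_def poly_eq_iff coeff_map_poly pderiv_add pderiv_diff)

lemma deriv_t_mult: "deriv_t (f * g) = deriv_t f * g + f * deriv_t g"
proof -
  have sum: "pderiv (\<Sum>i\<in>S. p i) = (\<Sum>i\<in>S. pderiv (p i))" for S :: "nat set" and p :: "nat \<Rightarrow> complex poly"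
    by (induction S rule: infinite_finite_induct) (simp_all add: pderiv_add)
  show ?thesis
    by (rule poly_eqI, simp add: deriv_t_def coeff_map_poly coeff_mult sum sum.distrib[symmetric])
      (rule sum.cong, simp_all add: pderiv_mult algebra_simps)
qed

lemma deriv_t_shift_s: "deriv_t (shift_s n f) = shift_s n (deriv_t f)"
proof (induction f)
  case 0
  then show ?case by (simp add: deriv_t_def shift_s_def)
next
  case (pCons a f)
  have split: "pCons a f = [:a:] + var_s * f"
    by (simp add: var_s_def)
  show ?case
    unfolding split
    by (simp add: shift_s_add shift_s_mult deriv_t_add deriv_t_mult deriv_t_diff pCons.IH)
qed

lemmas cst_ops = shift_s_add shift_s_diff shift_s_mult shift_s_shift_s
  deriv_t_add deriv_t_diff deriv_t_mult deriv_t_shift_s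

lemma cst_const_simps:
  "[:[:a + b:]:] = [:[:a:]:] + ([:[:b:]:] :: cst)"
  "[:[:a - b:]:] = [:[:a:]:] - ([:[:b:]:] :: cst)"
  "[:[:a * b:]:] = [:[:a:]:] * ([:[:b:]:] :: cst)"
  "[:[:of_int n:]:] = (of_int n :: cst)"
  by (simp_all add: of_int_poly)

lemma clinear_shift_s: "clinear (shift_s n)"
  and clinear_deriv_t: "clinear deriv_t"
  by (rule clinearI; simp only: cst_ops scaleC_cst shift_s_const deriv_t_const pderiv_pCons pderiv_0;
      simp add: algebra_simps)+

lemma clinear_times: "clinear (\<lambda>f. g * f :: cst)"
  by (rule clinearI) (simp_all only: scaleC_cst algebra_simps)

lemma basis_bracket_antisym: "basis_bracket b a = - basis_bracket a b"
  by (cases a; cases b)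
    (simp_all add: add.commute complex_vector.scale_minus_left[symmetric] del: complex_vector.scale_minus_left)

text \<open>The bracket is the bilinear extension of \<open>basis_bracket\<close>, so the relation
  on basis elements suffices.\<close>

lemma bms_module_free_ext:
  fixes r :: "bms_basis \<Rightarrow> 'v::complex_vector \<Rightarrow> 'v"
  assumes lin: "\<And>b. clinear (r b)"
    and bracket: "\<And>a b v. free_ext (\<lambda>c. r c v) (basis_bracket a b) = r a (r b v) - r b (r a v)"
  shows "bms_module (\<lambda>x v. free_ext (\<lambda>b. r b v) x)"
  unfolding bms_module_def
proof (intro conjI allI)
  show "clinear (\<lambda>v. free_ext (\<lambda>b. r b v) x)" for x
    by (rule clinearI)
      (simp_all add: free_ext_def clinear_add[OF lin] clinear_scale[OF lin] scaleC_add_right sum.distrib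
        complex_vector.scale_sum_right scaleC_scaleC mult.commute)
  show "clinear (\<lambda>x. free_ext (\<lambda>b. r b v) x)" for v
    by (rule clinear_free_ext)
  show "free_ext (\<lambda>b. r b v) (bms_bracket x y) =
    free_ext (\<lambda>b. r b (free_ext (\<lambda>b. r b v) y)) x - free_ext (\<lambda>b. r b (free_ext (\<lambda>b. r b v) x)) y"
    for x y v
  proof -
    let ?X = "Poly_Mapping.keys x" and ?Y = "Poly_Mapping.keys y"
    have "free_ext (\<lambda>b. r b v) (bms_bracket x y) = free_ext (\<lambda>a. free_ext (\<lambda>b. r a (r b v) - r b (r a v)) y) x"
      by (simp add: bms_bracket_def clinear_free_ext_comp[OF clinear_free_ext] bracket)
    also have "\<dots> = free_ext (\<lambda>a. free_ext (\<lambda>b. r a (r b v)) y) x - free_ext (\<lambda>a. free_ext (\<lambda>b. r b (r a v)) y) x"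
      by (simp add: free_ext_def complex_vector.scale_right_diff_distrib sum_subtractf)
    \<comment> \<open>Interchanging the two finite sums puts the action of \<open>x\<close> inside
      that of \<open>y\<close>, as the second product of the commutator requires.\<close>
    also have "free_ext (\<lambda>a. free_ext (\<lambda>b. r b (r a v)) y) x = free_ext (\<lambda>b. free_ext (\<lambda>a. r b (r a v)) x) y"
      by (simp add: free_ext_def complex_vector.scale_sum_right mult.commute scaleC_scaleC
          sum.swap[of _ ?X ?Y])
    finally show ?thesis by (simp add: clinear_free_ext_comp[OF lin])
  qed
qed

section \<open>The module relations for \<open>Phi\<close>\<close>

context
  fixes lam \<alpha> \<beta> \<gamma> :: complex and h :: "complex poly"
begin

text \<open>From h = h(\<alpha>) + H (t - \<alpha>). The quadratic term in \<open>n\<close> is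
  absorbed into the factor t - n \<alpha>, which also governs the action of \<open>bW n\<close>, and
  no division is left.\<close>

lemma h_sub_eq: "[:h_sub \<alpha> h n:] =
  of_int n * ([:[:poly h \<alpha>:]:] + [:H_poly \<alpha> h:] * (var_t - of_int n * [:[:\<alpha>:]:]))"
proof -
  have h: "h = [:poly h \<alpha>:] + H_poly \<alpha> h * ([:0, 1:] - [:\<alpha>:])"
    using H_poly_mult[of \<alpha> h] by (simp add: algebra_simps)
  have "h_sub \<alpha> h n = of_int n * h - of_int n * (of_int n - 1) * [:\<alpha>:] * H_poly \<alpha> h"
    by (simp add: h_sub_def of_int_poly one_pCons mult_ac)
  also have "\<dots> = of_int n * ([:poly h \<alpha>:] + H_poly \<alpha> h * ([:0, 1:] - of_int n * [:\<alpha>:]))"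
    by (subst h) (simp add: algebra_simps)
  finally show ?thesis by (simp add: var_t_def of_int_poly mult.commute)
qed

lemma Phi_basis_eqs:
  "Phi_basis lam \<alpha> \<beta> \<gamma> h (bL n) f = [:[:lam powi n:]:] * ((var_s + of_int n *
     ([:[:poly h \<alpha>:]:] + [:H_poly \<alpha> h:] * (var_t - of_int n * [:[:\<alpha>:]:]))) * shift_s n f
     - of_int n * (var_t - of_int n * [:[:\<alpha>:]:]) * deriv_t (shift_s n f))"
  "Phi_basis lam \<alpha> \<beta> \<gamma> h (bW n) f =
     [:[:lam powi n:]:] * ((var_t - of_int n * [:[:\<alpha>:]:]) * shift_s n f)"
  "Phi_basis lam \<alpha> \<beta> \<gamma> h (bI n) f = [:[:lam powi n:]:] *
     (([:[:\<gamma>:]:] - of_int n * [:[:\<beta>:]:] * [:H_poly \<alpha> h:]) * shift_s n f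
     + of_int n * [:[:\<beta>:]:] * deriv_t (shift_s n f))"
  "Phi_basis lam \<alpha> \<beta> \<gamma> h (bJ n) f = [:[:lam powi n:]:] * ([:[:\<beta>:]:] * shift_s n f)"
proof -
  have "[:[:\<gamma>:] - smult (of_int n * \<beta>) (H_poly \<alpha> h):] =
    ([:[:\<gamma>:]:] - of_int n * [:[:\<beta>:]:] * [:H_poly \<alpha> h:] :: cst)"
    by (simp add: of_int_poly)
  then show "Phi_basis lam \<alpha> \<beta> \<gamma> h (bI n) f = [:[:lam powi n:]:] *
     (([:[:\<gamma>:]:] - of_int n * [:[:\<beta>:]:] * [:H_poly \<alpha> h:]) * shift_s n f
     + of_int n * [:[:\<beta>:]:] * deriv_t (shift_s n f))"
    by (simp only: Phi_basis.simps scaleC_cst cst_const_simps) (simp only: algebra_simps)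
qed (simp_all only: Phi_basis.simps scaleC_cst cst_const_simps h_sub_eq algebra_simps)

lemma clinear_Phi_basis: "clinear (Phi_basis lam \<alpha> \<beta> \<gamma> h b)"
  by (rule clinearI; cases b;
      simp only: Phi_basis_eqs scaleC_cst cst_ops deriv_t_const shift_s_const pderiv_pCons pderiv_0)
    (simp_all add: algebra_simps del: mult_pCons_left mult_pCons_right)

text \<open>Shifts and t-derivatives are moved through all products. Each bracket relation then is a
  ring identity in the shifted polynomial, its t-derivatives and \<open>H_poly\<close>, where only
  the exact division already carried out in \<open>h_sub_eq\<close> matters.\<close>

lemma bms_module_Phi:
  assumes "lam \<noteq> 0"
  shows "bms_module (Phi lam \<alpha> \<beta> \<gamma> h)"
proof -
  let ?r = "Phi_basis lam \<alpha> \<beta> \<gamma> h"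
  define P where "P a b \<longleftrightarrow>
    (\<forall>v. free_ext (\<lambda>c. ?r c v) (basis_bracket a b) = ?r a (?r b v) - ?r b (?r a v))" for a b
  \<comment> \<open>The exponents are arbitrary integers, so this law uses
    \<open>lam \<noteq> 0\<close>.\<close>
  have powi: "[:[:lam powi (m + n):]:] = [:[:lam powi m:]:] * ([:[:lam powi n:]:] :: cst)" for m n
    using assms by (simp add: power_int_add)
  have const: "deriv_t [:[:c:]:] = 0" for c by (simp add: pderiv_pCons)
  note simps = P_def basis_bracket.simps clinear_scale[OF clinear_free_ext] free_ext_gen
    clinear_0[OF clinear_free_ext]
    Phi_basis_eqs scaleC_cst cst_const_simps(4) powi cst_ops const add.commute[of n m for m n :: int]
    shift_s_const shift_s_var_s shift_s_var_t shift_s_of_int deriv_t_var_s deriv_t_var_t deriv_t_of_int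
  have "P (bL m) (bL n)" for m n
    by (simp only: simps) (simp add: algebra_simps del: mult_pCons_left mult_pCons_right)
  moreover have "P (bL m) (bW n)" for m n
    by (simp only: simps) (simp add: algebra_simps del: mult_pCons_left mult_pCons_right)
  moreover have "P (bL m) (bI n)" for m n
    by (simp only: simps) (simp add: algebra_simps del: mult_pCons_left mult_pCons_right)
  moreover have "P (bL m) (bJ n)" for m n
    by (simp only: simps) (simp add: algebra_simps del: mult_pCons_left mult_pCons_right)
  moreover have "P (bW m) (bI n)" for m n
    by (simp only: simps) (simp add: algebra_simps del: mult_pCons_left mult_pCons_right)
  moreover have "P (bW m) (bW n)" "P (bW m) (bJ n)" "P (bI m) (bI n)" "P (bI m) (bJ n)"
    "P (bJ m) (bJ n)" for m n
    by (simp_all only: simps) (simp_all add: algebra_simps del: mult_pCons_left mult_pCons_right)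
  \<comment> \<open>Both sides are antisymmetric, so ten of the sixteen pairs of basis types
    suffice.\<close>
  moreover have "P b a" if "P a b" for a b
  proof -
    have "free_ext (\<lambda>c. ?r c v) (basis_bracket b a) = - free_ext (\<lambda>c. ?r c v) (basis_bracket a b)" for v
      using clinear_diff[OF clinear_free_ext, of "\<lambda>c. ?r c v" 0 "basis_bracket a b"]
      by (simp add: basis_bracket_antisym[of b a] clinear_0[OF clinear_free_ext])
    with that show ?thesis by (simp add: P_def)
  qed
  ultimately have "P a b" for a b by (cases a; cases b) auto
  then have "bms_module (\<lambda>x v. free_ext (\<lambda>b. ?r b v) x)"
    by (intro bms_module_free_ext clinear_Phi_basis) (simp add: P_def)
  then show ?thesis by (simp add: Phi_def[abs_def])
qed

end
section \<open>Operators on one tensor factor\<close>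

text \<open>The extension of \<open>slot i A\<close> to the full tensor product by the identity on
  the restricted module.\<close>

definition leg :: "'i \<Rightarrow> ('a \<Rightarrow> 'a) \<Rightarrow>
    (('i, 'a::complex_vector) mtensor, 'v::complex_vector) tensor \<Rightarrow> (('i, 'a) mtensor, 'v) tensor"
  where "leg i A = tensor_map (slot i A) (\<lambda>v. v)"

lemma clinear_leg: "clinear A \<Longrightarrow> clinear (leg i A)"
  and leg_pure: "clinear A \<Longrightarrow> leg i A (mpure f \<otimes>\<^sub>C v) = mpure (f(i := A (f i))) \<otimes>\<^sub>C v"
  unfolding leg_def by (simp_all add: clinear_tensor_map clinear_slot clinear_id tensor_map_pure slot_mpure)

lemma
  assumes A: "clinear A" and B: "clinear B"
  shows leg_add: "leg i (\<lambda>x. A x + B x) u = leg i A u + leg i B u"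
    and leg_diff: "leg i (\<lambda>x. A x - B x) u = leg i A u - leg i B u"
    and leg_compose: "leg i (\<lambda>x. A (B x)) u = leg i A (leg i B u)"
  by (rule mpure_pure_eqI; simp add: assms clinear_leg clinear_plus clinear_minus
      clinear_compose[OF A B] clinear_compose[OF clinear_leg[OF A] clinear_leg[OF B]]
      leg_pure clinear_add[OF clinear_mpure] clinear_diff[OF clinear_mpure]
      clinear_add[OF clinear_pure(2)] clinear_diff[OF clinear_pure(2)])+

lemma leg_scale: "clinear A \<Longrightarrow> leg i (\<lambda>x. c *\<^sub>C A x) u = c *\<^sub>C leg i A u"
  by (rule mpure_pure_eqI) (simp_all add: clinear_leg clinear_scaled leg_pure
      clinear_scale[OF clinear_mpure] clinear_scale[OF clinear_pure(2)])

lemma leg_id: "leg i (\<lambda>x. x) u = u"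
  by (rule mpure_pure_eqI) (simp_all add: clinear_leg clinear_id leg_pure)

lemma leg_zero: "leg i (\<lambda>x. 0) u = 0"
  using leg_diff[OF clinear_id clinear_id, of i u] by simp

text \<open>Operators on different factors always commute, so commutation of \<open>A\<close> and
  \<open>B\<close> is only asked for when \<open>i = j\<close>.\<close>

lemma leg_commute:
  assumes A: "clinear A" and B: "clinear B" and "i = j \<Longrightarrow> (\<lambda>x. A (B x)) = (\<lambda>x. B (A x))"
  shows "leg i A (leg j B u) = leg j B (leg i A u)"
proof (cases "i = j")
  case True
  then show ?thesis using assms by (simp add: leg_compose[OF A B, symmetric] leg_compose[OF B A, symmetric])
next
  case False
  show ?thesis
  proof (rule mpure_pure_eqI[where f = "\<lambda>u. leg i A (leg j B u)"])
    show "leg i A (leg j B (mpure f \<otimes>\<^sub>C v)) = leg j B (leg i A (mpure f \<otimes>\<^sub>C v))" for f v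
      using False by (simp add: A B leg_pure fun_upd_twist[of i j])
  qed (rule clinear_compose[OF clinear_leg[OF A] clinear_leg[OF B]]
      clinear_compose[OF clinear_leg[OF B] clinear_leg[OF A]])+
qed

lemma leg_funpow: "clinear A \<Longrightarrow> (leg i A ^^ k) u = leg i (A ^^ k) u"
proof (induction k)
  case 0
  then show ?case by (simp add: id_def leg_id)
next
  case (Suc k)
  then show ?case using leg_compose[OF Suc.prems clinear_funpow[OF Suc.prems, of k], of i u]
    by (simp add: comp_def)
qed

lemma mpure_upd_zero: "mpure (f(i := 0)) = 0"
  using clinear_0[OF clinear_mpure] .

lemma pure_zero: "0 \<otimes>\<^sub>C v = 0"
  using clinear_0[OF clinear_pure(2)] .

section \<open>Taylor expansion of the shift in s\<close>

lemma clinear_pderiv: "clinear (pderiv :: cst \<Rightarrow> cst)"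
  by (rule clinearI) (simp_all add: pderiv_add scaleC_cst pderiv_smult)

text \<open>
  Up to the sign \<open>(-1)\<^sup>k\<close> these are the divided powers \<open>\<partial>\<^sub>s\<^sup>k / k!\<close>: the coefficients of the
  polynomial \<open>n \<mapsto> f(s - n, t)\<close>.
\<close>

primrec divided_deriv :: "nat \<Rightarrow> cst \<Rightarrow> cst" where
  "divided_deriv 0 f = f"
| "divided_deriv (Suc k) f = (- 1 / of_nat (Suc k)) *\<^sub>C pderiv (divided_deriv k f)"

lemma divided_deriv_zero [simp]: "divided_deriv 0 = (\<lambda>f. f)"
  by (simp add: fun_eq_iff)

lemma clinear_divided_deriv: "clinear (divided_deriv k)"
proof (induction k)
  case 0
  then show ?case using clinear_id by simp
next
  case (Suc k)
  have "clinear (\<lambda>f. (- 1 / of_nat (Suc k)) *\<^sub>C pderiv (divided_deriv k f))"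
    by (intro clinear_scaled clinear_compose[OF clinear_pderiv Suc])
  then show ?case by simp
qed

lemma scaleC_pCons_0: "c *\<^sub>C pCons 0 f = pCons 0 (c *\<^sub>C f)" for f :: cst
  by (simp add: scaleC_cst)

text \<open>The Leibniz rule for the product of s and \<open>f\<close>: the second derivative of s
  is zero, and the factorials leave the coefficient 1 up to sign.\<close>

lemma divided_deriv_pCons_Suc:
  "divided_deriv (Suc k) (pCons a f) = pCons 0 (divided_deriv (Suc k) f) - divided_deriv k f"
proof (induction k)
  case 0
  then show ?case by (simp add: scaleC_one pderiv_pCons)
next
  case (Suc k)
  have "pderiv (divided_deriv k f) = (- of_nat (Suc k)) *\<^sub>C divided_deriv (Suc k) f"
    by (simp add: scaleC_scaleC scaleC_one del: of_nat_Suc)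
  then have "divided_deriv (Suc (Suc k)) (pCons a f) = (- 1 / of_nat (Suc (Suc k))) *\<^sub>C
    (divided_deriv (Suc k) f + pCons 0 (pderiv (divided_deriv (Suc k) f)) + of_nat (Suc k) *\<^sub>C divided_deriv (Suc k) f)"
    by (subst divided_deriv.simps(2), subst Suc)
      (simp add: pderiv_diff pderiv_pCons del: divided_deriv.simps of_nat_Suc)
  also have "divided_deriv (Suc k) f + pCons 0 (pderiv (divided_deriv (Suc k) f)) + of_nat (Suc k) *\<^sub>C divided_deriv (Suc k) f
    = of_nat (Suc (Suc k)) *\<^sub>C divided_deriv (Suc k) f + pCons 0 (pderiv (divided_deriv (Suc k) f))"
    by (subst of_nat_Suc[of "Suc k"]) (simp only: scaleC_add_left scaleC_one add_ac)
  also have "(- 1 / of_nat (Suc (Suc k))) *\<^sub>C \<dots> = pCons 0 (divided_deriv (Suc (Suc k)) f) - divided_deriv (Suc k) f"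
    by (simp only: divided_deriv.simps(2)[of "Suc k"])
      (simp add: scaleC_add_right scaleC_scaleC scaleC_pCons_0 scaleC_one del: divided_deriv.simps of_nat_Suc)
  finally show ?case .
qed

text \<open>Taylor's formula, by induction along a + s f. It is stated for every large
  \<open>d\<close> so that finitely many vectors or factors can share one degree.\<close>

lemma shift_s_taylor:
  "\<exists>d\<^sub>0. \<forall>d\<ge>d\<^sub>0. (\<forall>k>d. divided_deriv k f = 0) \<and>
    (\<forall>n. shift_s n f = (\<Sum>k\<le>d. (of_int n ^ k) *\<^sub>C divided_deriv k f))"
proof (induction f)
  case 0
  then show ?case
    using clinear_0[OF clinear_divided_deriv] by (simp add: shift_s_def)
next
  case (pCons a f)
  then obtain d\<^sub>0 where d\<^sub>0: "\<And>d. d \<ge> d\<^sub>0 \<Longrightarrow> (\<forall>k>d. divided_deriv k f = 0) \<and>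
    (\<forall>n. shift_s n f = (\<Sum>k\<le>d. (of_int n ^ k) *\<^sub>C divided_deriv k f))" by blast
  have "(\<forall>k>d. divided_deriv k (pCons a f) = 0) \<and>
    (\<forall>n. shift_s n (pCons a f) = (\<Sum>k\<le>d. (of_int n ^ k) *\<^sub>C divided_deriv k (pCons a f)))"
    if "d \<ge> Suc d\<^sub>0" for d
  proof (intro conjI allI impI)
    from that obtain e where e: "d = Suc e" "e \<ge> d\<^sub>0" by (cases d) auto
    fix n
    show "divided_deriv k (pCons a f) = 0" if "k > d" for k
    proof -
      from that e obtain l where "k = Suc l" "l > e" by (cases k) auto
      then show ?thesis using d\<^sub>0[OF e(2)] by (simp only: divided_deriv_pCons_Suc) auto
    qed
    let ?g = "\<lambda>k. (of_int n ^ k) *\<^sub>C divided_deriv k f"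
    have split: "pCons b g = [:b:] + var_s * g" for b and g :: cst
      by (simp add: var_s_def)
    \<comment> \<open>After the term \<open>k = 0\<close> is split off, the Leibniz rule yields two
      sums for \<open>f\<close>, one up to \<open>d\<close> and one up to \<open>e = d - 1\<close>.
      Both equal the shift of \<open>f\<close>, as both bounds are at least
      \<open>d\<^sub>0\<close>.\<close>
    have "(\<Sum>k\<le>d. (of_int n ^ k) *\<^sub>C divided_deriv k (pCons a f)) =
      pCons a f + (\<Sum>k\<le>e. var_s * ?g (Suc k) - of_int n *\<^sub>C ?g k)"
      unfolding e(1)
      by (subst sum.atMost_Suc_shift, simp only: divided_deriv_pCons_Suc)
        (simp add: complex_vector.scale_right_diff_distrib scaleC_scaleC scaleC_one scaleC_pCons_0
          var_s_def del: divided_deriv.simps(2))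
    also have "\<dots> = [:a:] + var_s * (\<Sum>k\<le>d. ?g k) - of_int n *\<^sub>C (\<Sum>k\<le>e. ?g k)"
      unfolding e(1)
      by (subst sum.atMost_Suc_shift)
        (simp add: sum_subtractf sum_distrib_left complex_vector.scale_sum_right scaleC_one split[of a f]
          distrib_left del: divided_deriv.simps(2))
    also have "\<dots> = [:a:] + (var_s - of_int n) * shift_s n f"
      using d\<^sub>0[of d] d\<^sub>0[of e] e by (simp add: scaleC_cst of_int_poly left_diff_distrib)
    also have "\<dots> = shift_s n (pCons a f)"
      by (simp add: split[of a f] shift_s_add shift_s_mult)
    finally show "shift_s n (pCons a f) = (\<Sum>k\<le>d. (of_int n ^ k) *\<^sub>C divided_deriv k (pCons a f))" ..
  qed
  then show ?case by blast
qed

text \<open>The bound depends on the vector. Those vectors that have one form a subspace, where sums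
  use the larger bound, and it contains the pure tensors.\<close>

lemma leg_shift_s_taylor:
  fixes u :: "(('i, cst) mtensor, 'v::complex_vector) tensor"
  shows "\<exists>d\<^sub>0. \<forall>d\<ge>d\<^sub>0. (\<forall>k>d. leg i (divided_deriv k) u = 0) \<and>
    (\<forall>n. leg i (shift_s n) u = (\<Sum>k\<le>d. (of_int n ^ k) *\<^sub>C leg i (divided_deriv k) u))"
proof -
  note lin = clinear_leg[OF clinear_divided_deriv] clinear_leg[OF clinear_shift_s]
  define Q where "Q d u \<longleftrightarrow> (\<forall>k>d. leg i (divided_deriv k) u = 0) \<and>
    (\<forall>n. leg i (shift_s n) u = (\<Sum>k\<le>d. (of_int n ^ k) *\<^sub>C leg i (divided_deriv k) u))"
    for d and u :: "(('i, cst) mtensor, 'v) tensor"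
  define P where "P = {u. \<exists>d\<^sub>0. \<forall>d\<ge>d\<^sub>0. Q d u}"
  have Q: "Q d 0" "Q d u \<Longrightarrow> Q d v \<Longrightarrow> Q d (u + v)" "Q d u \<Longrightarrow> Q d (c *\<^sub>C u)" for d u v c
    by (simp_all add: Q_def clinear_0[OF lin(1)] clinear_0[OF lin(2)] clinear_add[OF lin(1)] clinear_add[OF lin(2)]
        clinear_scale[OF lin(1)] clinear_scale[OF lin(2)] scaleC_add_right sum.distrib
        complex_vector.scale_sum_right scaleC_scaleC mult.commute)
  have "complex_vector.subspace P"
  proof (rule complex_vector.subspaceI)
    show "u + v \<in> P" if uv: "u \<in> P" "v \<in> P" for u v
    proof -
      from uv obtain d e where "\<forall>k\<ge>d. Q k u" "\<forall>k\<ge>e. Q k v" by (auto simp: P_def)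
      then have "\<forall>k\<ge>max d e. Q k (u + v)" using Q(2) by simp
      then show ?thesis unfolding P_def by blast
    qed
  qed (unfold P_def, blast intro: Q(1), blast intro: Q(3))
  moreover have "mpure f \<otimes>\<^sub>C v \<in> P" for f v
  proof -
    obtain d\<^sub>0 where d\<^sub>0: "\<And>d. d \<ge> d\<^sub>0 \<Longrightarrow> (\<forall>k>d. divided_deriv k (f i) = 0) \<and>
      (\<forall>n. shift_s n (f i) = (\<Sum>k\<le>d. (of_int n ^ k) *\<^sub>C divided_deriv k (f i)))"
      using shift_s_taylor by blast
    have "Q d (mpure f \<otimes>\<^sub>C v)" if "d \<ge> d\<^sub>0" for d
      using d\<^sub>0[OF that]
      by (simp add: Q_def leg_pure clinear_divided_deriv clinear_shift_s mpure_upd_zero pure_zero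
          clinear_sum[OF clinear_mpure] clinear_scale[OF clinear_mpure]
          clinear_sum[OF clinear_pure(2)] clinear_scale[OF clinear_pure(2)])
    then show ?thesis unfolding P_def by blast
  qed
  ultimately have "u \<in> P" by (rule mpure_pure_induct)
  then show ?thesis by (simp add: P_def Q_def)
qed

section \<open>Locally nilpotent commuting operators and their kernels\<close>

lemma nilpotent_pderiv: "\<exists>k. (pderiv ^^ k) p = 0" for p :: "'a::{idom,ring_char_0} poly"
proof (induction "degree p" arbitrary: p rule: less_induct)
  case less
  show ?case
  proof (cases "degree p = 0")
    case True
    then have "(pderiv ^^ 1) p = 0" by (simp add: pderiv_eq_0_iff)
    then show ?thesis by blast
  next
    case False
    then obtain k where "(pderiv ^^ k) (pderiv p) = 0"
      using less.hyps[of "pderiv p"] by (auto simp: degree_pderiv)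
    then have "(pderiv ^^ Suc k) p = 0" by (simp add: funpow_swap1)
    then show ?thesis by blast
  qed
qed

lemma funpow_zero_mono:
  fixes A :: "'a::complex_vector \<Rightarrow> 'a"
  assumes "clinear A" "(A ^^ k) u = 0" "k \<le> l"
  shows "(A ^^ l) u = 0"
proof -
  from \<open>k \<le> l\<close> have "l = (l - k) + k" by simp
  then have "(A ^^ l) u = (A ^^ (l - k)) ((A ^^ k) u)" by (metis funpow_add comp_apply)
  then show ?thesis using assms by (simp add: clinear_0[OF clinear_funpow])
qed

lemma subspace_nilpotent:
  fixes A :: "'a::complex_vector \<Rightarrow> 'a"
  assumes A: "clinear A"
  shows "complex_vector.subspace {u. \<exists>k. (A ^^ k) u = 0}"
proof (rule complex_vector.subspaceI)
  note lin = clinear_funpow[OF A]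
  show "0 \<in> {u. \<exists>k. (A ^^ k) u = 0}" using clinear_0[OF lin] by blast
  show "u + v \<in> {u. \<exists>k. (A ^^ k) u = 0}"
    if uv: "u \<in> {u. \<exists>k. (A ^^ k) u = 0}" "v \<in> {u. \<exists>k. (A ^^ k) u = 0}" for u v
  proof -
    from uv obtain k l where "(A ^^ k) u = 0" "(A ^^ l) v = 0" by blast
    then have "(A ^^ max k l) (u + v) = 0"
      using funpow_zero_mono[OF A, of k u "max k l"] funpow_zero_mono[OF A, of l v "max k l"]
      by (simp add: clinear_add[OF lin])
    then show ?thesis by blast
  qed
  show "c *\<^sub>C u \<in> {u. \<exists>k. (A ^^ k) u = 0}" if "u \<in> {u. \<exists>k. (A ^^ k) u = 0}" for c u
    using that by (auto simp: clinear_scale[OF lin])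
qed

lemma nilpotent_deriv_t: "\<exists>k. (deriv_t ^^ k) f = 0"
proof -
  have deriv_t_pCons: "deriv_t (pCons a f) = pCons (pderiv a) (deriv_t f)" for a f
    by (simp add: deriv_t_def map_poly_pCons)
  then have pow: "(deriv_t ^^ k) (pCons a f) = pCons ((pderiv ^^ k) a) ((deriv_t ^^ k) f)" for k a f
    by (induction k) simp_all
  show ?thesis
  proof (induction f)
    case 0
    have "(deriv_t ^^ 0) 0 = 0" by simp
    then show ?case by blast
  next
    case (pCons a f)
    then obtain k l where k: "(deriv_t ^^ k) f = 0" and l: "(pderiv ^^ l) a = 0"
      using nilpotent_pderiv by blast
    have zero: "(pderiv ^^ m) (0 :: complex poly) = 0" for m by (induction m) simp_all
    have "(pderiv ^^ (k + l)) a = 0" using l zero by (simp add: funpow_add)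
    moreover have "(deriv_t ^^ (k + l)) f = 0"
      using funpow_zero_mono[OF clinear_deriv_t k, of "k + l"] by simp
    ultimately have "(deriv_t ^^ (k + l)) (pCons a f) = 0" by (simp add: pow)
    then show ?case by blast
  qed
qed

text \<open>The exponent varies with the vector, so the vectors killed by some power are treated as
  a subspace containing the pure tensors.\<close>

lemma nilpotent_leg:
  assumes A: "clinear A" and "\<And>f. \<exists>k. (A ^^ k) f = 0"
  shows "\<exists>k. (leg i A ^^ k) u = 0"
proof -
  have "mpure f \<otimes>\<^sub>C v \<in> {u. \<exists>k. (leg i A ^^ k) u = 0}" for f v
  proof -
    from assms obtain k where "(A ^^ k) (f i) = 0" by blast
    then have "(leg i A ^^ k) (mpure f \<otimes>\<^sub>C v) = 0"
      by (simp add: leg_funpow A leg_pure clinear_funpow mpure_upd_zero pure_zero)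
    then show ?thesis by blast
  qed
  then have "u \<in> {u. \<exists>k. (leg i A ^^ k) u = 0}"
    by (rule mpure_pure_induct[OF subspace_nilpotent[OF clinear_leg[OF A]]])
  then show ?thesis by blast
qed

text \<open>Given a vector killed by \<open>Z\<close>, the last nonzero iterate under a further
  operator \<open>A\<close> is killed by \<open>A\<close>, and by commutation still by
  \<open>Z\<close>.\<close>

lemma common_kernel:
  fixes N :: "'a::complex_vector set"
  assumes "finite Z" "\<And>A. A \<in> Z \<Longrightarrow> clinear A" "\<And>A u. A \<in> Z \<Longrightarrow> u \<in> N \<Longrightarrow> A u \<in> N"
    and "\<And>A u. A \<in> Z \<Longrightarrow> \<exists>k. (A ^^ k) u = 0"
    and "\<And>A B u. A \<in> Z \<Longrightarrow> B \<in> Z \<Longrightarrow> A (B u) = B (A u)"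
    and "u \<in> N" "u \<noteq> 0"
  shows "\<exists>u \<in> N. u \<noteq> 0 \<and> (\<forall>A \<in> Z. A u = 0)"
  using assms
proof (induction Z rule: finite_induct)
  case empty
  then show ?case by blast
next
  case (insert A Z)
  have "\<exists>u \<in> N. u \<noteq> 0 \<and> (\<forall>A \<in> Z. A u = 0)"
    by (rule insert.IH) (rule insert.prems; simp)+
  then obtain u where u: "u \<in> N" "u \<noteq> 0" "\<forall>A\<in>Z. A u = 0" by (elim bexE conjE)
  \<comment> \<open>Since \<open>u\<close> is nonzero, this exponent is positive, and its
    predecessor \<open>l\<close> gives the last nonzero iterate.\<close>
  define k where "k = (LEAST k. (A ^^ k) u = 0)"
  have k: "(A ^^ k) u = 0" unfolding k_def by (rule LeastI_ex) (rule insert.prems(3), simp)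
  with u(2) obtain l where l: "k = Suc l" by (cases k) auto
  have nz: "(A ^^ l) u \<noteq> 0" using not_less_Least[of l "\<lambda>k. (A ^^ k) u = 0"] l by (simp add: k_def[symmetric])
  have "(A ^^ l) u \<in> N" by (induction l) (use u insert.prems(2)[of A] in simp_all)
  moreover have "B ((A ^^ l) u) = 0" if "B \<in> insert A Z" for B
  proof (cases "B = A")
    case True
    then show ?thesis using k l by simp
  next
    case False
    have "B (A u) = A (B u)" for u using that by (intro insert.prems(4)) auto
    then have "B ((A ^^ l) u) = (A ^^ l) (B u)" by (induction l) simp_all
    also have "B u = 0" using u(3) that False by simp
    finally show ?thesis using insert.prems(1)[of A] by (simp add: clinear_0[OF clinear_funpow])
  qed
  ultimately show ?case using nz by blast
qed

text \<open>
  With \<open>B\<close> a linear right inverse of \<open>A\<close>, the operator \<open>1 - B A\<close> maps into the kernel of \<open>A\<close>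
  and acts on \<open>u\<close> as the identity.
\<close>

lemma leg_fixes_kernel:
  fixes A E :: "'a::complex_vector \<Rightarrow> 'a"
  assumes A: "clinear A" and E: "clinear E" and "surj A" and fixed: "\<And>f. A f = 0 \<Longrightarrow> E f = f"
    and u: "leg i A u = 0"
  shows "leg i E u = u"
proof -
  interpret vector_space_pair "scaleC :: complex \<Rightarrow> 'a \<Rightarrow> 'a" "scaleC :: complex \<Rightarrow> 'a \<Rightarrow> 'a"
    by standard
  obtain B where B: "clinear B" "A \<circ> B = id"
    using linear_surjective_right_inverse[OF A \<open>surj A\<close>] by blast
  have BA: "clinear (\<lambda>f. B (A f))" by (rule clinear_compose[OF B(1) A])
  define K where "K f = f - B (A f)" for f
  have K: "clinear K" unfolding K_def by (intro clinear_minus clinear_id BA)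
  have "A (K f) = 0" for f
    using B(2) by (simp add: K_def clinear_diff[OF A] fun_eq_iff)
  then have EK: "(\<lambda>f. E (K f)) = K" using fixed by blast
  have "leg i K u = u"
    unfolding K_def by (simp add: leg_diff[OF clinear_id BA] leg_compose[OF B(1) A] u leg_id
        clinear_0[OF clinear_leg[OF B(1)]])
  then show ?thesis using leg_compose[OF E K, of i u] EK by simp
qed

lemma surj_pderiv: "surj (pderiv :: 'a::{field_char_0} poly \<Rightarrow> _)"
proof (rule surjI)
  fix p :: "'a poly"
  have sum: "pderiv (\<Sum>i\<in>S. q i) = (\<Sum>i\<in>S. pderiv (q i))" for S :: "nat set" and q :: "nat \<Rightarrow> 'a poly"
    by (induction S rule: infinite_finite_induct) (simp_all add: pderiv_add)
  show "pderiv (\<Sum>i\<le>degree p. monom (coeff p i / of_nat (Suc i)) (Suc i)) = p"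
    by (simp add: sum pderiv_monom poly_as_sum_of_monoms del: of_nat_Suc)
qed

text \<open>The coefficients lie in a polynomial ring and not in a field, so the antiderivative
  divides by integers through \<open>smult\<close>.\<close>

lemma surj_pderiv_cst: "surj (pderiv :: cst \<Rightarrow> cst)"
proof (rule surjI)
  fix p :: cst
  have sum: "pderiv (\<Sum>i\<in>S. q i) = (\<Sum>i\<in>S. pderiv (q i))" for S :: "nat set" and q :: "nat \<Rightarrow> cst"
    by (induction S rule: infinite_finite_induct) (simp_all add: pderiv_add)
  have "of_nat (Suc i) * smult (1 / of_nat (Suc i)) q = q" for i and q :: "complex poly"
    by (simp add: of_nat_poly del: of_nat_Suc)
  then show "pderiv (\<Sum>i\<le>degree p. monom (smult (1 / of_nat (Suc i)) (coeff p i)) (Suc i)) = p"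
    by (simp add: sum pderiv_monom poly_as_sum_of_monoms del: of_nat_Suc)
qed

lemma surj_deriv_t: "surj deriv_t"
proof (rule surjI)
  fix f :: cst
  \<comment> \<open>A right inverse of \<open>pderiv\<close> that is forced to send 0 to 0, as
    \<open>map_poly\<close> needs in order to act on every coefficient.\<close>
  define R :: "complex poly \<Rightarrow> complex poly" where "R p = (if p = 0 then 0 else inv pderiv p)" for p
  have "R 0 = 0" "pderiv (R p) = p" for p
    by (simp_all add: R_def surj_f_inv_f[OF surj_pderiv])
  then show "deriv_t (map_poly R f) = f"
    by (simp add: deriv_t_def poly_eq_iff coeff_map_poly)
qed

section \<open>Vacuum vectors\<close>

definition const_part :: "cst \<Rightarrow> cst" where "const_part f = [:[:coeff (coeff f 0) 0:]:]"

text \<open>\<open>const_part\<close> is the composition of setting s = 0 and setting t = 0. The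
  first fixes the kernel of \<open>pderiv\<close>, the second that of \<open>deriv_t\<close>, so
  \<open>leg_fixes_kernel\<close> applies to each.\<close>

lemma leg_const_part:
  assumes "leg i pderiv u = 0" "leg i deriv_t u = 0"
  shows "leg i const_part u = u"
proof -
  define E\<^sub>s E\<^sub>t :: "cst \<Rightarrow> cst" where "E\<^sub>s f = [:coeff f 0:]" and "E\<^sub>t f = map_poly (\<lambda>p. [:coeff p 0:]) f" for f
  have lin: "clinear E\<^sub>s" "clinear E\<^sub>t"
    by (rule clinearI; simp add: E\<^sub>s_def E\<^sub>t_def poly_eq_iff coeff_map_poly scaleC_cst coeff_pCons split: nat.split)+
  have "leg i E\<^sub>s u = u"
    by (rule leg_fixes_kernel[OF clinear_pderiv lin(1) surj_pderiv_cst _ assms(1)])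
      (auto simp: E\<^sub>s_def pderiv_eq_0_iff elim: degree_eq_zeroE)
  moreover have "leg i E\<^sub>t u = u"
  proof (rule leg_fixes_kernel[OF clinear_deriv_t lin(2) surj_deriv_t _ assms(2)])
    fix f assume "deriv_t f = 0"
    then have "pderiv (coeff f k) = 0" for k
      using coeff_map_poly[of pderiv f k] by (simp add: deriv_t_def)
    then have "degree (coeff f k) = 0" for k by (simp add: pderiv_eq_0_iff)
    then have "[:coeff (coeff f k) 0:] = coeff f k" for k by (metis coeff_pCons_0 degree_eq_zeroE)
    then show "E\<^sub>t f = f" by (simp add: E\<^sub>t_def poly_eq_iff[of _ f] coeff_map_poly)
  qed
  moreover have "const_part = (\<lambda>f. E\<^sub>s (E\<^sub>t f))"
    by (simp add: const_part_def E\<^sub>s_def E\<^sub>t_def fun_eq_iff coeff_map_poly)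
  ultimately show ?thesis using leg_compose[OF lin, of i u] by simp
qed

text \<open>Projecting one slot after another replaces each polynomial by a multiple of 1. After all
  slots, \<open>u\<close> is in the span of vectors with 1 in every slot, and these already form a
  subspace.\<close>

lemma const_part_fixed_imp_vacuum:
  fixes u :: "(('i::finite, cst) mtensor, 'v::complex_vector) tensor"
  assumes "\<And>i. leg i const_part u = u"
  obtains v where "u = mpure (\<lambda>_. 1) \<otimes>\<^sub>C v"
proof -
  define G :: "'i set \<Rightarrow> (('i, cst) mtensor, 'v) tensor set"
    where "G Z = {mpure f \<otimes>\<^sub>C v | f v. \<forall>i\<in>Z. f i = 1}" for Z
  have lin: "clinear const_part"
    by (rule clinearI) (simp_all add: const_part_def scaleC_cst)
  have "u \<in> complex_vector.span (G Z)" if "finite Z" for Z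
    using that
  proof (induction Z)
    case empty
    show ?case
      by (rule mpure_pure_induct) (auto simp: G_def intro: complex_vector.span_base)
  next
    case (insert i Z)
    let ?P = "{x. leg i const_part x \<in> complex_vector.span (G (insert i Z))}"
    have "leg i const_part x \<in> complex_vector.span (G (insert i Z))" if "x \<in> G Z" for x
    proof -
      from that obtain f v where f: "x = mpure f \<otimes>\<^sub>C v" "\<forall>i\<in>Z. f i = 1" by (auto simp: G_def)
      have "const_part (f i) = coeff (coeff (f i) 0) 0 *\<^sub>C 1"
        by (simp add: const_part_def scaleC_cst one_pCons)
      then have "leg i const_part x = coeff (coeff (f i) 0) 0 *\<^sub>C (mpure (f(i := 1)) \<otimes>\<^sub>C v)"
        by (simp add: f leg_pure lin clinear_scale[OF clinear_mpure] clinear_scale[OF clinear_pure(2)])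
      moreover have "mpure (f(i := 1)) \<otimes>\<^sub>C v \<in> G (insert i Z)" using f(2) by (auto simp: G_def)
      ultimately show ?thesis
        by (simp add: complex_vector.span_base complex_vector.span_scale)
    qed
    then have "complex_vector.span (G Z) \<subseteq> ?P"
      by (intro complex_vector.span_minimal subspace_clinear_vimage[OF clinear_leg[OF lin]]) auto
    then show ?case using insert.IH assms[of i] by auto
  qed
  then have "u \<in> complex_vector.span (G UNIV)" by simp
  moreover have "complex_vector.subspace (range (\<lambda>v. mpure (\<lambda>_. 1) \<otimes>\<^sub>C v))"
    by (auto simp: complex_vector.subspace_def image_iff clinear_0[OF clinear_pure(1)]
        clinear_add[OF clinear_pure(1), symmetric] clinear_scale[OF clinear_pure(1), symmetric]
        intro: clinear_0[OF clinear_pure(1)])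
  moreover have "G UNIV \<subseteq> range (\<lambda>v. mpure (\<lambda>_. 1) \<otimes>\<^sub>C v)"
    by (auto simp: G_def) (metis (full_types) ext rangeI)
  ultimately show thesis using that complex_vector.span_minimal by blast
qed

text \<open>Any pure tensor arises from a vacuum vector by multiplying its slots one at a time by
  the desired polynomials.\<close>

lemma vacuum_generates:
  fixes N :: "(('i::finite, cst) mtensor, 'v::complex_vector) tensor set"
  assumes N: "complex_vector.subspace N" and times: "\<And>i g u. u \<in> N \<Longrightarrow> leg i (\<lambda>f. g * f) u \<in> N"
    and vac: "\<And>v. mpure (\<lambda>_. 1) \<otimes>\<^sub>C v \<in> N"
  shows "N = UNIV"
proof -
  have "\<forall>f. (\<forall>i. i \<notin> Z \<longrightarrow> f i = 1) \<longrightarrow> mpure f \<otimes>\<^sub>C v \<in> N" if "finite Z" for Z and v :: 'v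
    using that
  proof (induction Z)
    case empty
    show ?case
    proof (intro allI impI)
      fix f :: "'i \<Rightarrow> cst" assume "\<forall>i. i \<notin> {} \<longrightarrow> f i = 1"
      then have "f = (\<lambda>_. 1)" by auto
      then show "mpure f \<otimes>\<^sub>C v \<in> N" using vac by simp
    qed
  next
    case (insert i Z)
    show ?case
    proof (intro allI impI)
      fix f :: "'i \<Rightarrow> cst" assume "\<forall>j. j \<notin> insert i Z \<longrightarrow> f j = 1"
      then have "mpure (f(i := 1)) \<otimes>\<^sub>C v \<in> N" using insert.IH by simp
      from times[OF this, of i "f i"] show "mpure f \<otimes>\<^sub>C v \<in> N"
        by (simp add: leg_pure clinear_times)
    qed
  qed
  from this[of UNIV] have "mpure f \<otimes>\<^sub>C v \<in> N" for f v by simp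
  then show ?thesis using mpure_pure_induct[OF N] by blast
qed

text \<open>The product of the constant terms of all factors, times the vector in the last factor,
  defines a linear map that sends the given tensor to \<open>v\<close>.\<close>

lemma vacuum_nonzero:
  fixes v :: "'v::complex_vector"
  assumes "mpure (\<lambda>_ :: 'i::finite. 1 :: cst) \<otimes>\<^sub>C v = 0"
  shows "v = 0"
proof -
  define F :: "('i \<Rightarrow> cst) \<Rightarrow> complex" where "F f = (\<Prod>i\<in>UNIV. coeff (coeff (f i) 0) 0)" for f
  have "F (f(i := x)) = coeff (coeff x 0) 0 * (\<Prod>j\<in>UNIV - {i}. coeff (coeff (f j) 0) 0)" for f i x
    unfolding F_def by (subst prod.remove[of _ i]) simp_all
  then have F: "multilinear F"
    unfolding multilinear_def
    by (intro allI clinearI) (simp_all add: scaleC_cst scaleC_complex_def algebra_simps)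
  have "bilinear2 (\<lambda>a b. mtensor_lift F a *\<^sub>C (b :: 'v))"
    unfolding bilinear2_def
    by (intro conjI allI clinearI)
      (simp_all add: clinear_add[OF clinear_mtensor_lift[OF F]] clinear_scale[OF clinear_mtensor_lift[OF F]]
        scaleC_add_left scaleC_add_right scaleC_scaleC scaleC_complex_def mult.commute)
  from tensor_lift_pure[OF this, of "mpure (\<lambda>_. 1)" v] clinear_0[OF clinear_tensor_lift[OF this]] assms
  show ?thesis by (simp add: mtensor_lift_mpure[OF F]) (simp add: F_def scaleC_one)
qed
section \<open>Submodules of the tensor product\<close>

lemma tensor_map_mtensor_act:
  fixes P :: "'m::finite \<Rightarrow> bms \<Rightarrow> 'a::complex_vector \<Rightarrow> 'a"
  assumes "\<And>i. bms_module (P i)"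
  shows "tensor_map (mtensor_act P x) (\<lambda>v. v) u = (\<Sum>i\<in>UNIV. leg i (P i x) u)"
proof (rule mpure_pure_eqI[where g = "\<lambda>u. \<Sum>i\<in>UNIV. leg i (P i x) u"])
  have lin: "clinear (P i x)" for i using assms by (simp add: bms_module_def)
  note act = mtensor_act_slot(2)[of P, OF assms]
  show "clinear (tensor_map (mtensor_act P x) (\<lambda>v. v))"
    by (rule clinear_tensor_map[OF act clinear_id])
  show "clinear (\<lambda>u. \<Sum>i\<in>UNIV. leg i (P i x) u)"
    by (intro clinear_sum_fun clinear_leg lin)
  show "tensor_map (mtensor_act P x) (\<lambda>v. v) (mpure f \<otimes>\<^sub>C v) = (\<Sum>i\<in>UNIV. leg i (P i x) (mpure f \<otimes>\<^sub>C v))"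
    for f v
    by (simp add: tensor_map_pure act clinear_id mtensor_act_mpure assms leg_pure lin clinear_sum[OF clinear_pure(2)])
qed

text \<open>Restrictedness gives a bound for each vector of the module. An element of the tensor
  product is a finite sum of pure tensors, so it has a common bound.\<close>

lemma restricted_tensor_map:
  fixes \<rho> :: "bms \<Rightarrow> 'v::complex_vector \<Rightarrow> 'v" and u :: "('a::complex_vector, 'v) tensor"
  assumes "bms_module \<rho>" "bms_restricted \<rho>"
  shows "\<exists>K. \<forall>n\<ge>K. \<forall>x\<in>bms_graded (int n). tensor_map (\<lambda>a. a) (\<rho> x) u = 0"
proof -
  define Q where "Q n u \<longleftrightarrow> (\<forall>x\<in>bms_graded (int n). tensor_map (\<lambda>a. a) (\<rho> x) u = 0)"
    for n and u :: "('a, 'v) tensor"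
  have lin: "clinear (\<rho> x)" for x using assms by (simp add: bms_module_def)
  note tm = clinear_tensor_map[OF clinear_id lin]
  have Q: "Q n 0" "Q n u \<Longrightarrow> Q n v \<Longrightarrow> Q n (u + v)" "Q n u \<Longrightarrow> Q n (c *\<^sub>C u)" for n u v c
    by (simp_all add: Q_def clinear_0[OF tm] clinear_add[OF tm] clinear_scale[OF tm])
  define P where "P = {u. \<exists>K. \<forall>n\<ge>K. Q n u}"
  have "complex_vector.subspace P"
  proof (rule complex_vector.subspaceI)
    show "u + v \<in> P" if uv: "u \<in> P" "v \<in> P" for u v
    proof -
      from uv obtain k l where "\<forall>n\<ge>k. Q n u" "\<forall>n\<ge>l. Q n v" by (auto simp: P_def)
      then have "\<forall>n\<ge>max k l. Q n (u + v)" using Q(2) by simp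
      then show ?thesis unfolding P_def by blast
    qed
  qed (unfold P_def, blast intro: Q(1), blast intro: Q(3))
  moreover have "a \<otimes>\<^sub>C v \<in> P" for a v
  proof -
    obtain k where k: "\<And>n x. n \<ge> int k \<Longrightarrow> x \<in> bms_graded n \<Longrightarrow> \<rho> x v = 0"
      using assms(2) unfolding bms_restricted_def by metis
    have "Q n (a \<otimes>\<^sub>C v)" if "n \<ge> k" for n
      using that k[of "int n"]
      by (simp add: Q_def tensor_map_pure lin clinear_id clinear_0[OF clinear_pure(1)])
    then show ?thesis unfolding P_def by blast
  qed
  ultimately have "u \<in> P" by (rule pure_induct)
  then show ?thesis by (simp add: P_def Q_def)
qed

text \<open>Collects powers of \<open>z\<close> in A + z B + z^2 C; the nested cases encode that
  coefficients with negative index are zero.\<close>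

lemma sum_case_nat_shift:
  fixes a b c :: "nat \<Rightarrow> 'a::complex_vector"
  shows "(\<Sum>r\<le>Suc (Suc d). z ^ r *\<^sub>C (a r + (case r of 0 \<Rightarrow> 0 | Suc q \<Rightarrow> b q + (case q of 0 \<Rightarrow> 0 | Suc p \<Rightarrow> c p)))) =
    (\<Sum>r\<le>Suc (Suc d). z ^ r *\<^sub>C a r) + z *\<^sub>C (\<Sum>r\<le>Suc d. z ^ r *\<^sub>C b r) + z\<^sup>2 *\<^sub>C (\<Sum>r\<le>d. z ^ r *\<^sub>C c r)"
proof -
  have shift: "(\<Sum>r\<le>Suc m. z ^ r *\<^sub>C (case r of 0 \<Rightarrow> 0 | Suc q \<Rightarrow> g q)) = z *\<^sub>C (\<Sum>r\<le>m. z ^ r *\<^sub>C g r)"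
    for m and g :: "nat \<Rightarrow> 'a"
    by (subst sum.atMost_Suc_shift) (simp add: complex_vector.scale_sum_right scaleC_scaleC)
  show ?thesis
    by (simp only: scaleC_add_right sum.distrib shift scaleC_scaleC power2_eq_square add.assoc)
qed

context
  fixes lam :: "'m::finite \<Rightarrow> complex" and P :: "'m \<Rightarrow> bms \<Rightarrow> cst \<Rightarrow> cst"
    and \<rho> :: "bms \<Rightarrow> 'v::complex_vector \<Rightarrow> 'v" and N
  assumes lam: "\<And>i. lam i \<noteq> 0" "inj lam"
    and P: "\<And>i. bms_module (P i)" and \<rho>: "bms_module \<rho>" "bms_restricted \<rho>"
    and N: "bms_submodule (tensor_act (mtensor_act P) \<rho>) N"
begin

text \<open>Inserting the Taylor expansion, the coefficient of \<open>lam i ^ n * n ^ r\<close> in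
  the action of \<open>x n\<close> on \<open>u\<close> is C0 D_r + C1 D_(r-1) + C2 D_(r-2), with D_r
  the divided derivatives of \<open>u\<close> in factor \<open>i\<close>. All of these lie in
  \<open>N\<close> by \<open>exp_poly_coeff_mem\<close>; the conclusions are the cases r = 0, r = 1
  and r = k + 2.\<close>

lemma leg_coeff_mem:
  fixes C\<^sub>0 C\<^sub>1 C\<^sub>2 :: "'m \<Rightarrow> cst \<Rightarrow> cst"
  assumes C: "\<And>i. clinear (C\<^sub>0 i)" "\<And>i. clinear (C\<^sub>1 i)" "\<And>i. clinear (C\<^sub>2 i)"
    and x: "\<And>n. x n \<in> bms_graded (int n)"
    and expand: "\<And>i n f. P i (x n) f = lam i ^ n *\<^sub>C (C\<^sub>0 i (shift_s (int n) f)
      + of_nat n *\<^sub>C C\<^sub>1 i (shift_s (int n) f) + (of_nat n)\<^sup>2 *\<^sub>C C\<^sub>2 i (shift_s (int n) f))"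
    and "u \<in> N"
  shows "leg i (C\<^sub>0 i) u \<in> N"
    and "leg i (C\<^sub>0 i) (leg i (divided_deriv 1) u) + leg i (C\<^sub>1 i) u \<in> N"
    and "leg i (C\<^sub>0 i) (leg i (divided_deriv (Suc (Suc k))) u)
      + leg i (C\<^sub>1 i) (leg i (divided_deriv (Suc k)) u) + leg i (C\<^sub>2 i) (leg i (divided_deriv k) u) \<in> N"
proof -
  define D where "D i k = leg i (divided_deriv k) u" for i k
  define d\<^sub>0 where "d\<^sub>0 i = (SOME d\<^sub>0. \<forall>d\<ge>d\<^sub>0. \<forall>n. leg i (shift_s n) u = (\<Sum>k\<le>d. (of_int n ^ k) *\<^sub>C D i k))" for i
  have "\<exists>d\<^sub>0. \<forall>d\<ge>d\<^sub>0. \<forall>n. leg i (shift_s n) u = (\<Sum>k\<le>d. (of_int n ^ k) *\<^sub>C D i k)" for i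
    using leg_shift_s_taylor[of i u] unfolding D_def by blast
  then have d\<^sub>0: "leg i (shift_s n) u = (\<Sum>k\<le>d. (of_int n ^ k) *\<^sub>C D i k)" if "d \<ge> d\<^sub>0 i" for i d n
    using someI_ex[of "\<lambda>d\<^sub>0. \<forall>d\<ge>d\<^sub>0. \<forall>n. leg i (shift_s n) u = (\<Sum>k\<le>d. (of_int n ^ k) *\<^sub>C D i k)"] that
    unfolding d\<^sub>0_def by blast
  \<comment> \<open>One truncation degree for all factors; including \<open>k\<close> ensures that
    the exponent k + 2 is in the range of the sum.\<close>
  define d where "d = Max (insert k (range d\<^sub>0))"
  have d: "d \<ge> d\<^sub>0 i" "d \<ge> k" for i unfolding d_def by (intro Max_ge; simp)+
  have shift: "(\<Sum>k\<le>e. (of_nat n ^ k) *\<^sub>C D i k) = leg i (shift_s (int n)) u" if "e \<ge> d" for e i n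
    using d\<^sub>0[of i e "int n"] that d(1)[of i] by simp
  define w where "w i r = leg i (C\<^sub>0 i) (D i r) + (case r of 0 \<Rightarrow> 0 | Suc q \<Rightarrow>
    leg i (C\<^sub>1 i) (D i q) + (case q of 0 \<Rightarrow> 0 | Suc p \<Rightarrow> leg i (C\<^sub>2 i) (D i p)))" for i r
  have act: "(\<Sum>r\<le>Suc (Suc d). (lam i ^ n * of_nat n ^ r) *\<^sub>C w i r) = leg i (P i (x n)) u" for i n
  proof -
    note linC = clinear_leg[OF C(1)] clinear_leg[OF C(2)] clinear_leg[OF C(3)]
    note \<sigma> = clinear_shift_s[of "int n"]
    note comp = clinear_compose[OF C(1) \<sigma>] clinear_compose[OF C(2) \<sigma>] clinear_compose[OF C(3) \<sigma>]
    \<comment> \<open>Needed for every \<open>e \<ge> d\<close>, because the three parts of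
      \<open>w\<close> are summed up to \<open>d + 2\<close>, \<open>d + 1\<close> and
      \<open>d\<close>.\<close>
    have pull: "(\<Sum>k\<le>e. (of_nat n ^ k) *\<^sub>C leg i A (D i k)) = leg i A (leg i (shift_s (int n)) u)"
      if "e \<ge> d" "clinear A" for e A
      using clinear_sum[OF clinear_leg[OF that(2)], of i "\<lambda>k. (of_nat n ^ k) *\<^sub>C D i k" "{..e}"]
      by (simp add: shift that clinear_scale[OF clinear_leg])
    have "(\<Sum>r\<le>Suc (Suc d). (lam i ^ n * of_nat n ^ r) *\<^sub>C w i r) =
      lam i ^ n *\<^sub>C (\<Sum>r\<le>Suc (Suc d). of_nat n ^ r *\<^sub>C w i r)"
      by (simp only: scaleC_scaleC[symmetric] complex_vector.scale_sum_right)
    also have "(\<Sum>r\<le>Suc (Suc d). of_nat n ^ r *\<^sub>C w i r) = leg i (C\<^sub>0 i) (leg i (shift_s (int n)) u)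
      + of_nat n *\<^sub>C leg i (C\<^sub>1 i) (leg i (shift_s (int n)) u)
      + (of_nat n)\<^sup>2 *\<^sub>C leg i (C\<^sub>2 i) (leg i (shift_s (int n)) u)"
      unfolding w_def sum_case_nat_shift by (simp only: pull C le_SucI le_refl)
    also have "lam i ^ n *\<^sub>C \<dots> = leg i (\<lambda>f. P i (x n) f) u"
      unfolding expand
      by (simp add: leg_scale leg_add leg_compose clinear_plus clinear_scaled comp \<sigma> C)
    finally show ?thesis by simp
  qed
  \<comment> \<open>From \<open>K\<close> on the restricted module contributes nothing, and the
    action reduces to the sum over the polynomial factors.\<close>
  obtain K where K: "\<And>n y. n \<ge> K \<Longrightarrow> y \<in> bms_graded (int n) \<Longrightarrow> tensor_map (\<lambda>a. a) (\<rho> y) u = 0"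
    using restricted_tensor_map[OF \<rho>, of u] by blast
  have sub: "complex_vector.subspace N" using N by (simp add: bms_submodule_def)
  have mem: "(\<Sum>i\<in>UNIV. \<Sum>r\<le>Suc (Suc d). (lam i ^ n * of_nat n ^ r) *\<^sub>C w i r) \<in> N" if "n \<ge> K" for n
  proof -
    have "tensor_act (mtensor_act P) \<rho> (x n) u \<in> N"
      using N \<open>u \<in> N\<close> by (simp add: bms_submodule_def)
    then show ?thesis
      using K[OF that x]
      by (simp add: tensor_act_tensor_map(1)[OF bms_module_mtensor_act[of P, OF P] \<rho>(1)]
          tensor_map_mtensor_act[of P, OF P] act del: sum.atMost_Suc)
  qed
  have w: "w i r \<in> N" if "r \<le> Suc (Suc d)" for r
    using exp_poly_coeff_mem[OF sub finite lam(2) lam(1) mem, where i = i and r = r] that by simp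
  have "D i 0 = u" by (simp add: D_def leg_id)
  then show "leg i (C\<^sub>0 i) u \<in> N" using w[of 0] by (simp add: w_def)
  show "leg i (C\<^sub>0 i) (leg i (divided_deriv 1) u) + leg i (C\<^sub>1 i) u \<in> N"
    using w[of 1] \<open>D i 0 = u\<close> by (simp add: w_def) (simp add: D_def)
  show "leg i (C\<^sub>0 i) (leg i (divided_deriv (Suc (Suc k))) u)
      + leg i (C\<^sub>1 i) (leg i (divided_deriv (Suc k)) u) + leg i (C\<^sub>2 i) (leg i (divided_deriv k) u) \<in> N"
    using w[of "Suc (Suc k)"] d(2) by (simp add: w_def add.assoc) (simp add: D_def)
qed

end

text \<open>Sorts the actions by powers of \<open>n\<close>, padded with zero terms to the shape
  that \<open>leg_coeff_mem\<close> expects.\<close>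

lemma Phi_basis_nat:
  fixes h :: "complex poly" and f :: cst and n :: nat
  defines "g \<equiv> shift_s (int n) f"
  shows "Phi_basis lam \<alpha> \<beta> \<gamma> h (bL (int n)) f = lam ^ n *\<^sub>C (var_s * g
      + of_nat n *\<^sub>C (([:[:poly h \<alpha>:]:] + [:H_poly \<alpha> h:] * var_t) * g - var_t * deriv_t g)
      + (of_nat n)\<^sup>2 *\<^sub>C (\<alpha> *\<^sub>C (deriv_t g - [:H_poly \<alpha> h:] * g)))"
    and "Phi_basis lam \<alpha> \<beta> \<gamma> h (bW (int n)) f = lam ^ n *\<^sub>C (var_t * g
      + of_nat n *\<^sub>C ((- \<alpha>) *\<^sub>C g) + (of_nat n)\<^sup>2 *\<^sub>C 0)"
    and "Phi_basis lam \<alpha> \<beta> \<gamma> h (bI (int n)) f = lam ^ n *\<^sub>C (\<gamma> *\<^sub>C g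
      + of_nat n *\<^sub>C (\<beta> *\<^sub>C (deriv_t g - [:H_poly \<alpha> h:] * g)) + (of_nat n)\<^sup>2 *\<^sub>C 0)"
    and "Phi_basis lam \<alpha> \<beta> \<gamma> h (bJ (int n)) f = lam ^ n *\<^sub>C (\<beta> *\<^sub>C g
      + of_nat n *\<^sub>C 0 + (of_nat n)\<^sup>2 *\<^sub>C 0)"
proof -
  have of_nat: "[:[:of_nat n:]:] = (of_nat n :: cst)" "[:[:(of_nat n)\<^sup>2:]:] = (of_nat n ^ 2 :: cst)"
    "[:[:- \<alpha>:]:] = - ([:[:\<alpha>:]:] :: cst)"
    by (simp_all add: of_nat_poly power2_eq_square)
  note simps = Phi_basis_eqs scaleC_cst g_def[symmetric] power_int_of_nat of_nat of_int_of_nat_eq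
  show "Phi_basis lam \<alpha> \<beta> \<gamma> h (bL (int n)) f = lam ^ n *\<^sub>C (var_s * g
      + of_nat n *\<^sub>C (([:[:poly h \<alpha>:]:] + [:H_poly \<alpha> h:] * var_t) * g - var_t * deriv_t g)
      + (of_nat n)\<^sup>2 *\<^sub>C (\<alpha> *\<^sub>C (deriv_t g - [:H_poly \<alpha> h:] * g)))"
    by (simp only: simps) (simp add: algebra_simps power2_eq_square del: mult_pCons_left mult_pCons_right)
  show "Phi_basis lam \<alpha> \<beta> \<gamma> h (bW (int n)) f = lam ^ n *\<^sub>C (var_t * g
      + of_nat n *\<^sub>C ((- \<alpha>) *\<^sub>C g) + (of_nat n)\<^sup>2 *\<^sub>C 0)"
    by (simp only: simps) (simp add: algebra_simps del: minus_pCons mult_pCons_left mult_pCons_right)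
  show "Phi_basis lam \<alpha> \<beta> \<gamma> h (bI (int n)) f = lam ^ n *\<^sub>C (\<gamma> *\<^sub>C g
      + of_nat n *\<^sub>C (\<beta> *\<^sub>C (deriv_t g - [:H_poly \<alpha> h:] * g)) + (of_nat n)\<^sup>2 *\<^sub>C 0)"
    by (simp only: simps) (simp add: algebra_simps del: minus_pCons mult_pCons_left mult_pCons_right)
  show "Phi_basis lam \<alpha> \<beta> \<gamma> h (bJ (int n)) f = lam ^ n *\<^sub>C (\<beta> *\<^sub>C g
      + of_nat n *\<^sub>C 0 + (of_nat n)\<^sup>2 *\<^sub>C 0)"
    by (simp only: simps) (simp add: algebra_simps del: minus_pCons mult_pCons_left mult_pCons_right)
qed

section \<open>Stability of a submodule under multiplications and derivatives\<close>

context
  fixes lam \<alpha> \<beta> \<gamma> :: "'m::finite \<Rightarrow> complex" and h :: "'m \<Rightarrow> complex poly"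
    and \<rho> :: "bms \<Rightarrow> 'v::complex_vector \<Rightarrow> 'v" and N and P :: "'m \<Rightarrow> bms \<Rightarrow> cst \<Rightarrow> cst"
  defines "P \<equiv> (\<lambda>i. Phi (lam i) (\<alpha> i) (\<beta> i) (\<gamma> i) (h i))"
  assumes lam: "\<And>i. lam i \<noteq> 0" "inj lam" and nonzero: "\<And>i. \<alpha> i \<noteq> 0 \<or> \<beta> i \<noteq> 0"
    and \<rho>: "bms_module \<rho>" "bms_restricted \<rho>"
    and N: "bms_submodule (tensor_act (mtensor_act P) \<rho>) N"
begin

lemma bms_module_P: "bms_module (P i)"
  unfolding P_def by (rule bms_module_Phi[OF lam(1)])

lemma subspace_N: "complex_vector.subspace N"
  using N by (simp add: bms_submodule_def)

lemma P_gen: "P i (free_gen b) f = Phi_basis (lam i) (\<alpha> i) (\<beta> i) (\<gamma> i) (h i) b f"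
  by (simp add: P_def Phi_def)

lemma free_gen_graded:
  "free_gen (bL n) \<in> bms_graded n" "free_gen (bW n) \<in> bms_graded n"
  "free_gen (bI n) \<in> bms_graded n" "free_gen (bJ n) \<in> bms_graded n"
  by (simp_all add: bms_graded_def complex_vector.span_base)

lemma clinear_deriv_H: "clinear (\<lambda>g. deriv_t g - H * g)"
  by (intro clinear_minus clinear_deriv_t clinear_times)

lemmas N_coeff = leg_coeff_mem[of lam P \<rho> N, OF lam bms_module_P \<rho> N]

text \<open>Here and in the next three, the coefficient operators C0, C1, C2 are fixed by
  unification with the expansions in \<open>Phi_basis_nat\<close>.\<close>

lemmas L_coeff = N_coeff[where x = "\<lambda>n. free_gen (bL (int n))",
    OF clinear_times clinear_minus[OF clinear_times clinear_compose[OF clinear_times clinear_deriv_t]]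
      clinear_scaled[OF clinear_deriv_H] free_gen_graded(1) trans[OF P_gen Phi_basis_nat(1)]]

lemmas W_coeff = N_coeff[where x = "\<lambda>n. free_gen (bW (int n))",
    OF clinear_times clinear_scaled[OF clinear_id] clinear_zero free_gen_graded(2)
      trans[OF P_gen Phi_basis_nat(2)]]

lemmas I_coeff = N_coeff[where x = "\<lambda>n. free_gen (bI (int n))",
    OF clinear_scaled[OF clinear_id] clinear_scaled[OF clinear_deriv_H] clinear_zero free_gen_graded(3)
      trans[OF P_gen Phi_basis_nat(3)]]

lemmas J_coeff = N_coeff[where x = "\<lambda>n. free_gen (bJ (int n))",
    OF clinear_scaled[OF clinear_id] clinear_zero clinear_zero free_gen_graded(4)
      trans[OF P_gen Phi_basis_nat(4)]]

lemma N_scale_cancel: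
  assumes "c *\<^sub>C u \<in> N" "c \<noteq> 0"
  shows "u \<in> N"
  using complex_vector.subspace_scale[OF subspace_N assms(1), of "1 / c"] assms(2)
  by (simp add: scaleC_scaleC scaleC_one)

lemma N_cancel: "u + v \<in> N \<Longrightarrow> u \<in> N \<Longrightarrow> v \<in> N"
  using complex_vector.subspace_diff[OF subspace_N, of "u + v" u] by simp

text \<open>The coefficients of exponent 0 in the actions of W and L are the multiplications by t
  and s. A Horner induction, first in t and then in s, reaches every polynomial.\<close>

lemma N_times:
  assumes "u \<in> N"
  shows "leg i (\<lambda>f. g * f) u \<in> N"
proof -
  have const: "leg i (\<lambda>f. [:p:] * f) u \<in> N" if "u \<in> N" for p u
    using that
  proof (induction p arbitrary: u)
    case 0
    then show ?case using leg_zero[of i u] complex_vector.subspace_0[OF subspace_N] by simp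
  next
    case (pCons a p)
    have "(\<lambda>f. [:pCons a p:] * f) = (\<lambda>f. a *\<^sub>C f + var_t * ([:p:] * f))"
      by (simp add: fun_eq_iff scaleC_cst var_t_def smult_add_left[symmetric])
    moreover have "leg i (\<lambda>f. a *\<^sub>C f + var_t * ([:p:] * f)) u = a *\<^sub>C u + leg i (\<lambda>f. var_t * f) (leg i (\<lambda>f. [:p:] * f) u)"
      by (simp only: leg_add clinear_scaled clinear_id clinear_times
          clinear_compose[OF clinear_times clinear_times] leg_scale leg_compose leg_id)
    ultimately show ?case
      using pCons W_coeff(1)
      by (simp add: complex_vector.subspace_add complex_vector.subspace_scale subspace_N)
  qed
  show ?thesis
    using assms
  proof (induction g arbitrary: u)
    case 0
    then show ?case using leg_zero[of i u] complex_vector.subspace_0[OF subspace_N] by simp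
  next
    case (pCons p g)
    have "(\<lambda>f. pCons p g * f) = (\<lambda>f. [:p:] * f + var_s * (g * f))"
      by (simp add: fun_eq_iff var_s_def)
    moreover have "leg i (\<lambda>f. [:p:] * f + var_s * (g * f)) u =
      leg i (\<lambda>f. [:p:] * f) u + leg i (\<lambda>f. var_s * f) (leg i (\<lambda>f. g * f) u)"
      by (simp only: leg_add clinear_times clinear_compose[OF clinear_times clinear_times] leg_compose)
    ultimately show ?case
      using const[of u p] pCons L_coeff(1)
      by (simp add: complex_vector.subspace_add subspace_N)
  qed
qed

text \<open>
  For \<open>\<alpha> \<noteq> 0\<close> the coefficients of \<open>W\<^sub>n u\<close> are \<open>t D\<^sub>k u - \<alpha> D\<^bsub>k-1\<^esub> u\<close>, where \<open>D\<^sub>k\<close> is the divided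
  derivative; since \<open>D\<^sub>k u = 0\<close> for large \<open>k\<close>, a descending induction on \<open>k\<close> applies.
\<close>

lemma N_divided_deriv:
  assumes "u \<in> N"
  shows "leg i (divided_deriv k) u \<in> N"
proof (cases "\<alpha> i = 0")
  case True
  then have "\<beta> i \<noteq> 0" using nonzero[of i] by simp
  have J: "leg i (\<lambda>g. \<beta> i *\<^sub>C g) u = \<beta> i *\<^sub>C u" for u
    by (simp add: leg_scale clinear_id leg_id)
  note J_coeff = J_coeff[unfolded leg_zero, simplified]
  show ?thesis
  proof (cases k)
    case 0
    then show ?thesis using assms by (simp add: leg_id)
  next
    case (Suc l)
    \<comment> \<open>Here \<beta> is nonzero and the coefficients of the action of J are \<beta>
      times the divided derivatives. Exponent \<open>l + 1\<close> is the case r = 1 for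
      \<open>l = 0\<close>, and otherwise the case r = (l - 1) + 2.\<close>
    have "leg i (\<lambda>g. \<beta> i *\<^sub>C g) (leg i (divided_deriv (Suc l)) u) \<in> N"
      using J_coeff(2)[OF assms, of i] J_coeff(3)[OF assms, of i "l - 1"] by (cases l) simp_all
    then show ?thesis using N_scale_cancel[OF _ \<open>\<beta> i \<noteq> 0\<close>] Suc by (simp only: J)
  qed
next
  case False
  obtain d where d: "\<And>k. k > d \<Longrightarrow> leg i (divided_deriv k) u = 0"
    using leg_shift_s_taylor[of i u] by blast
  have step: "leg i (divided_deriv k) u \<in> N" if k: "leg i (divided_deriv (Suc k)) u \<in> N" for k
  proof -
    have "leg i (\<lambda>f. var_t * f) (leg i (divided_deriv (Suc k)) u)
      + leg i (\<lambda>g. (- \<alpha> i) *\<^sub>C g) (leg i (divided_deriv k) u) \<in> N"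
      using W_coeff(2)[OF assms, of i] W_coeff(3)[OF assms, of i "k - 1"]
      by (cases k) (simp_all add: leg_zero leg_id del: divided_deriv.simps(2))
    then have "leg i (\<lambda>g. (- \<alpha> i) *\<^sub>C g) (leg i (divided_deriv k) u) \<in> N"
      using N_cancel N_times[OF k] by blast
    then show ?thesis
      using N_scale_cancel[of "- \<alpha> i"] False by (simp only: leg_scale clinear_id leg_id) simp
  qed
  have "leg i (divided_deriv (k + m)) u \<in> N \<Longrightarrow> leg i (divided_deriv k) u \<in> N" for m
    by (induction m) (simp_all add: step del: divided_deriv.simps(2))
  moreover have "leg i (divided_deriv (k + Suc d)) u \<in> N"
    using d[of "k + Suc d"] complex_vector.subspace_0[OF subspace_N] by simp
  ultimately show ?thesis by blast
qed

lemma N_pderiv: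
  assumes "u \<in> N"
  shows "leg i pderiv u \<in> N"
proof -
  have "divided_deriv 1 = (\<lambda>f. (- 1) *\<^sub>C pderiv f)" by (simp add: fun_eq_iff)
  then have "(- 1) *\<^sub>C leg i pderiv u \<in> N"
    using N_divided_deriv[OF assms, of i 1] leg_scale[OF clinear_pderiv, of i "- 1" u] by simp
  then show ?thesis by (rule N_scale_cancel) simp
qed

text \<open>The operator \<partial>_t - H occurs times \<beta> in the linear coefficient of I and
  times \<alpha> in the quadratic coefficient of L. Whichever parameter is nonzero isolates it, the
  other summands being in \<open>N\<close> already; adding back the multiplication by H gives
  \<partial>_t.\<close>

lemma N_deriv_t:
  assumes "u \<in> N"
  shows "leg i deriv_t u \<in> N"
proof -
  let ?A = "\<lambda>g. deriv_t g - [:H_poly (\<alpha> i) (h i):] * g"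
  have "leg i ?A u \<in> N"
  proof (cases "\<alpha> i = 0")
    case True
    then have "\<beta> i \<noteq> 0" using nonzero[of i] by simp
    have "leg i (\<lambda>g. \<gamma> i *\<^sub>C g) (leg i (divided_deriv 1) u) \<in> N"
      using N_divided_deriv[OF assms, of i 1] complex_vector.subspace_scale[OF subspace_N]
      by (simp only: leg_scale clinear_id leg_id)
    with I_coeff(2)[OF assms, of i] have "leg i (\<lambda>g. \<beta> i *\<^sub>C ?A g) u \<in> N" by (rule N_cancel)
    then have "\<beta> i *\<^sub>C leg i ?A u \<in> N" by (simp only: leg_scale clinear_deriv_H)
    then show ?thesis using \<open>\<beta> i \<noteq> 0\<close> by (rule N_scale_cancel)
  next
    case False
    let ?C = "\<lambda>g. ([:[:poly (h i) (\<alpha> i):]:] + [:H_poly (\<alpha> i) (h i):] * var_t) * g - var_t * deriv_t g"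
    \<comment> \<open>The linear coefficient of L, minus s times the first divided
      derivative.\<close>
    have C: "leg i ?C v \<in> N" if "v \<in> N" for v
      using L_coeff(2)[OF that, of i] N_times[OF N_divided_deriv[OF that]] by (rule N_cancel)
    have "leg i (\<lambda>f. var_s * f) (leg i (divided_deriv (Suc (Suc 0))) u)
      + leg i ?C (leg i (divided_deriv (Suc 0)) u) \<in> N"
      by (intro complex_vector.subspace_add[OF subspace_N] C N_times N_divided_deriv assms)
    with L_coeff(3)[OF assms, of i 0]
    have "leg i (\<lambda>g. \<alpha> i *\<^sub>C ?A g) (leg i (divided_deriv 0) u) \<in> N" by (rule N_cancel)
    then have "\<alpha> i *\<^sub>C leg i ?A u \<in> N" by (simp only: leg_scale clinear_deriv_H leg_id divided_deriv_zero)
    then show ?thesis using False by (rule N_scale_cancel)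
  qed
  then have "leg i ?A u + leg i (\<lambda>g. [:H_poly (\<alpha> i) (h i):] * g) u \<in> N"
    by (intro complex_vector.subspace_add[OF subspace_N] N_times assms)
  then show ?thesis by (simp only: leg_diff[OF clinear_deriv_t clinear_times] diff_add_cancel)
qed

text \<open>The derivatives in s and t of all factors commute, are locally nilpotent and preserve
  \<open>N\<close>. A nonzero common kernel vector in \<open>N\<close> is fixed by every
  \<open>const_part\<close>, hence is a vacuum vector.\<close>

lemma N_contains_vacuum:
  assumes "N \<noteq> {0}"
  obtains v where "v \<noteq> 0" "mpure (\<lambda>_. 1) \<otimes>\<^sub>C v \<in> N"
proof -
  obtain u where u: "u \<in> N" "u \<noteq> 0"
    using assms complex_vector.subspace_0[OF subspace_N] by blast
  define Z where "Z = (\<Union>A\<in>{pderiv, deriv_t}. range (\<lambda>i :: 'm. leg i A :: _ \<Rightarrow> ((_, cst) mtensor, 'v) tensor))"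
  have pderiv_deriv_t: "pderiv (deriv_t f) = deriv_t (pderiv f)" for f
    by (simp add: poly_eq_iff deriv_t_def coeff_map_poly coeff_pderiv of_nat_poly pderiv_smult del: of_nat_Suc)
  have AB: "clinear A" "\<exists>k. (A ^^ k) f = 0" "(\<lambda>f. A (B f)) = (\<lambda>f. B (A f))"
    if "A \<in> {pderiv, deriv_t}" "B \<in> {pderiv, deriv_t}" for A B f
    using that clinear_pderiv clinear_deriv_t nilpotent_deriv_t nilpotent_pderiv by (auto simp: pderiv_deriv_t)
  have "\<exists>u\<in>N. u \<noteq> 0 \<and> (\<forall>A\<in>Z. A u = 0)"
  proof (rule common_kernel[OF _ _ _ _ _ u])
    show "finite Z" by (simp add: Z_def)
    show "A v \<in> N" if "A \<in> Z" "v \<in> N" for A v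
      using that by (auto simp: Z_def intro: N_pderiv N_deriv_t)
    show "clinear A" if "A \<in> Z" for A
      using that by (auto simp: Z_def intro: clinear_leg clinear_pderiv clinear_deriv_t)
    show "\<exists>k. (A ^^ k) v = 0" if "A \<in> Z" for A v
      using that unfolding Z_def by (blast intro: nilpotent_leg AB)
    show "A (B v) = B (A v)" if "A \<in> Z" "B \<in> Z" for A B v
      using that unfolding Z_def by (elim UN_E rangeE) (simp only:, rule leg_commute; (rule AB)?; simp)
  qed
  then obtain w where w: "w \<in> N" "w \<noteq> 0" "\<And>i. leg i pderiv w = 0" "\<And>i. leg i deriv_t w = 0"
    by (auto simp: Z_def)
  from const_part_fixed_imp_vacuum[OF leg_const_part[OF w(3,4)]]
  obtain v where "w = mpure (\<lambda>_. 1) \<otimes>\<^sub>C v" .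
  moreover from this have "v \<noteq> 0" using w(2) by (auto simp: clinear_0[OF clinear_pure(1)])
  ultimately show thesis using w(1) that by blast
qed

lemma N_eq_UNIV:
  assumes "bms_irreducible \<rho>" "N \<noteq> {0}"
  shows "N = UNIV"
proof -
  define M where "M = {v. mpure (\<lambda>_. 1) \<otimes>\<^sub>C v \<in> N}"
  have "\<rho> x v \<in> M" if "v \<in> M" for x v
  proof -
    let ?w = "mpure (\<lambda>_ :: 'm. 1 :: cst) \<otimes>\<^sub>C v"
    have w: "?w \<in> N" using that by (simp add: M_def)
    have lin: "clinear (P i x)" for i using bms_module_P by (simp add: bms_module_def)
    \<comment> \<open>On the vacuum the action of \<open>x\<close> in factor \<open>i\<close> agrees
      with multiplication by the polynomial \<open>P i x 1\<close>, which preserves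
      \<open>N\<close>. So the part of the action on \<open>v\<close> remains in \<open>N\<close>,
      and \<open>M\<close> is a submodule.\<close>
    have "leg i (P i x) ?w = leg i (\<lambda>f. P i x 1 * f) ?w" for i
      by (simp add: leg_pure lin clinear_times)
    then have "(\<Sum>i\<in>UNIV. leg i (P i x) ?w) \<in> N"
      using N_times[OF w] by (intro complex_vector.subspace_sum[OF subspace_N]) simp
    moreover have "tensor_act (mtensor_act P) \<rho> x ?w \<in> N"
      using N w by (simp add: bms_submodule_def)
    moreover have "tensor_act (mtensor_act P) \<rho> x ?w =
      (\<Sum>i\<in>UNIV. leg i (P i x) ?w) + mpure (\<lambda>_. 1) \<otimes>\<^sub>C \<rho> x v"
      using \<rho>(1)
      by (simp add: tensor_act_tensor_map(1)[OF bms_module_mtensor_act[of P, OF bms_module_P] \<rho>(1)]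
          tensor_map_mtensor_act[of P, OF bms_module_P])
        (simp add: tensor_map_pure clinear_id bms_module_def)
    ultimately show ?thesis using N_cancel by (simp add: M_def)
  qed
  then have "bms_submodule \<rho> M"
    unfolding bms_submodule_def M_def
    using subspace_clinear_vimage[OF clinear_pure(1) subspace_N] by blast
  moreover from N_contains_vacuum[OF assms(2)] have "M \<noteq> {0}" by (auto simp: M_def)
  ultimately have "M = UNIV" using assms(1) unfolding bms_irreducible_def by blast
  then show ?thesis
    using vacuum_generates[OF subspace_N N_times] by (auto simp: M_def)
qed

end

theorem theorem3p4:
  fixes lam \<alpha> \<beta> \<gamma> :: "'m::finite \<Rightarrow> complex"
    and h :: "'m \<Rightarrow> complex poly"
    and \<rho> :: "bms \<Rightarrow> 'v::complex_vector \<Rightarrow> 'v"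
  assumes "\<And>i. lam i \<noteq> 0"
    and "\<And>i. \<alpha> i \<noteq> 0 \<or> \<beta> i \<noteq> 0"
    and "bms_irreducible \<rho>"
    and "bms_restricted \<rho>"
    and "\<And>i j. i \<noteq> j \<Longrightarrow> lam i \<noteq> lam j"
  shows "bms_irreducible
    (tensor_act (mtensor_act (\<lambda>i. Phi (lam i) (\<alpha> i) (\<beta> i) (\<gamma> i) (h i))) \<rho>)"
proof -
  let ?T = "tensor_act (mtensor_act (\<lambda>i. Phi (lam i) (\<alpha> i) (\<beta> i) (\<gamma> i) (h i))) \<rho>"
  have \<rho>: "bms_module \<rho>" using assms(3) by (simp add: bms_irreducible_def)
  obtain v :: 'v where "v \<noteq> 0" using assms(3) by (auto simp: bms_irreducible_def)
  \<comment> \<open>A vacuum vector over a nonzero \<open>v\<close> shows that the tensor product is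
    nonzero.\<close>
  then have "\<exists>w :: (('m, cst) mtensor, 'v) tensor. w \<noteq> 0"
    using vacuum_nonzero[where 'i = 'm] by blast
  moreover have "bms_module ?T"
    by (intro bms_module_tensor_act bms_module_mtensor_act bms_module_Phi assms(1) \<rho>)
  moreover have "N = {0} \<or> N = UNIV" if "bms_submodule ?T N" for N
    using N_eq_UNIV[OF assms(1) _ assms(2) \<rho> assms(4) that assms(3)] assms(5)
    by (auto simp: inj_def)
  ultimately show ?thesis by (simp add: bms_irreducible_def)
qed

end
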